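(* Let $u\in H^{2}((t_{0},t_{m}),\mathbb{R}^{n})$ be a minimizer of $E(u)+E_{WC}(u)$ over all of $H^{2}((t_{0},t_{m}),\mathbb{R}^{n})$, and write $u(t)=\sum_{i=1}^{n}\omega_{i}(t)\phi_{i}$. Then: (i) for every $i$ and every $k=1,\dots,m$, the restriction of $\omega_i$ to $(t_{k-1},t_k)$ is smooth and satisfies $$\omega_i''''+2(\lambda_i-2\delta_i^2)\,\omega_i''+\lambda_i(\lambda_i\omega_i+g_i)=0,$$ so $u=\sum_i\omega_i\phi_i$ with each $\omega_i$ a wiggly spline with nodes $t_0,\dots,t_m$; (ii) $u$ is continuously differentiable on $[t_0,t_m]$, in particular once differentiable at every node; (iii) $u$ is twice differentiable at every interior node $t_k$ ($1\le k\le m-1$) at which no velocity is prescribed, i.e. the one-sided second derivatives of $u$ at $t_k$ coincide.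
   Context: Let $M\in\mathbb{R}^{n\times n}$ be symmetric positive definite, $K\in\mathbb{R}^{n\times n}$ symmetric positive semidefinite, $\alpha,\beta\ge 0$, $D=\alpha M+\beta K$, $g\in\mathbb{R}^n$ constant, and $t_0<t_1<\dots<t_m$ nodes. For $u\in H^{2}((t_{0},t_{m}),\mathbb{R}^{n})$ let $$E(u)=\frac12\int_{t_0}^{t_m}\big\|M\ddot u+D\dot u+Ku+g\big\|_{M^{-1}}^2\,dt,\qquad \|x\|_{M^{-1}}^2=x^TM^{-1}x.$$ Let $W:\mathbb{R}^n\to\mathbb{R}^n$ be a twice continuously differentiable (nonlinear) warp map with derivative $DW$. For given matrices $A_k,B_k$ (with $n$ columns, possibly with zero rows), vectors $a_k,b_k$ of matching sizes, and positive constants $c_A,c_B$, define $$E_{WC}(u)=\frac12\sum_{k=0}^{m}\Big(c_A\|A_kW(u(t_k))-a_k\|^2+c_B\|B_k\,DW(u(t_k))\,\dot u(t_k)-b_k\|^2\Big).$$ "No velocity is prescribed at $t_k$" means $B_k$ has no rows. Let $\phi_1,\dots,\phi_n$ be an $M$-orthonormal basis with $K\phi_i=\lambda_iM\phi_i$, $\delta_i=(\alpha+\beta\lambda_i)/2$, and $g_i=\phi_i^Tg$ (so $g=\sum_ig_iM\phi_i$). Elements of $H^2$ are identified with their continuously differentiable representatives. *)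

theory Defs
  imports "HOL-Analysis.Analysis"
begin

text \<open>Sobolev space H^2((a,b),R^n) in its standard one-dimensional characterization,
  via the continuously differentiable representative u: u has classical derivative u'
  on [a,b], and u' is the indefinite integral of a square-integrable function u''
  (the weak second derivative).\<close>
definition H2_on :: "real \<Rightarrow> real \<Rightarrow> (real \<Rightarrow> 'a::euclidean_space) \<Rightarrow> (real \<Rightarrow> 'a) \<Rightarrow> (real \<Rightarrow> 'a) \<Rightarrow> bool" where
  "H2_on a b u u' u'' \<longleftrightarrow>
     (\<forall>t\<in>{a..b}. (u has_vector_derivative u' t) (at t within {a..b})) \<and>
     u'' absolutely_integrable_on {a..b} \<and>
     (\<lambda>s. (norm (u'' s))\<^sup>2) integrable_on {a..b} \<and>
     (\<forall>t\<in>{a..b}. u' t = u' a + integral {a..t} u'')"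

definition Minv_norm2 :: "real^'n^'n \<Rightarrow> real^'n \<Rightarrow> real" where
  "Minv_norm2 M x = x \<bullet> (matrix_inv M *v x)"

definition energyE :: "real^'n^'n \<Rightarrow> real^'n^'n \<Rightarrow> real^'n^'n \<Rightarrow> real^'n \<Rightarrow> real \<Rightarrow> real \<Rightarrow>
    (real \<Rightarrow> real^'n) \<Rightarrow> (real \<Rightarrow> real^'n) \<Rightarrow> (real \<Rightarrow> real^'n) \<Rightarrow> real" where
  "energyE M D K g a b u u' u'' =
     1/2 * integral {a..b} (\<lambda>t. Minv_norm2 M (M *v u'' t + D *v u' t + K *v u t + g))"

text \<open>Squared Euclidean norm of (R x - c), where the matrix R is given by the list of its
  rows (possibly empty, i.e. a matrix with zero rows) and c is a vector of matching length.\<close>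
definition resid2 :: "(real^'n) list \<Rightarrow> real list \<Rightarrow> real^'n \<Rightarrow> real" where
  "resid2 R c x = (\<Sum>j<length R. ((R ! j) \<bullet> x - c ! j)\<^sup>2)"

definition energyWC :: "real \<Rightarrow> real \<Rightarrow> (nat \<Rightarrow> (real^'n) list) \<Rightarrow> (nat \<Rightarrow> real list) \<Rightarrow>
    (nat \<Rightarrow> (real^'n) list) \<Rightarrow> (nat \<Rightarrow> real list) \<Rightarrow> (real^'n \<Rightarrow> real^'n) \<Rightarrow> (real^'n \<Rightarrow> real^'n^'n) \<Rightarrow>
    (nat \<Rightarrow> real) \<Rightarrow> nat \<Rightarrow> (real \<Rightarrow> real^'n) \<Rightarrow> (real \<Rightarrow> real^'n) \<Rightarrow> real" where
  "energyWC cA cB A a B b W DW t m u u' =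
     1/2 * (\<Sum>k\<le>m. cA * resid2 (A k) (a k) (W (u (t k)))
                  + cB * resid2 (B k) (b k) (DW (u (t k)) *v u' (t k)))"

definition smooth_real_on :: "real set \<Rightarrow> (real \<Rightarrow> real) \<Rightarrow> (nat \<Rightarrow> real \<Rightarrow> real) \<Rightarrow> bool" where
  "smooth_real_on S f F \<longleftrightarrow> (\<forall>t\<in>S. F 0 t = f t) \<and>
     (\<forall>j. \<forall>t\<in>S. (F j has_real_derivative F (Suc j) t) (at t))"

end

theory Submission
  imports Defs
begin

text \<open>
  Vary \<open>u\<close> only in the direction of one mode, \<open>v = u + \<eta> \<phi>\<^sub>i\<close> with \<open>\<eta> = \<integral>\<integral>\<psi>\<close>. If \<open>\<eta>\<close> vanishes at every
  node and \<open>\<eta>'\<close> vanishes at every node with a velocity constraint, then \<open>E_WC\<close> does not change, so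
  minimality gives \<open>\<integral> (\<eta>'' + 2 \<delta>\<^sub>i \<eta>' + \<lambda>\<^sub>i \<eta>) r = 0\<close> for \<open>r = \<omega>\<^sub>i'' + 2 \<delta>\<^sub>i \<omega>\<^sub>i' + \<lambda>\<^sub>i \<omega>\<^sub>i + g\<^sub>i\<close>.
  Integrating by parts onto \<open>\<psi> = \<eta>''\<close> and introducing Lagrange
  multipliers for the finitely many linear constraints on \<open>\<psi>\<close> shows
  \<open>r = -2 \<delta>\<^sub>i P - \<lambda>\<^sub>i Q + \<Sum> c\<^sub>k (t\<^sub>k - s)\<^sub>+ + \<Sum> d\<^sub>k 1[s \<le> t\<^sub>k]\<close> almost everywhere, where \<open>P = \<integral>\<^sub>s r\<close>, \<open>Q = \<integral>\<^sub>s P\<close>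
  and \<open>d\<^sub>k\<close> occurs only where a velocity is prescribed. The right-hand side is continuous away from those
  nodes, and away from all nodes it can be bootstrapped to \<open>r'' = 2 \<delta>\<^sub>i r' - \<lambda>\<^sub>i r\<close>.
\<close>

section \<open>Bounded measurable functions as a class of test functions\<close>

text \<open>This is the class of admissible second derivatives \<open>\<psi>\<close> of a variation.
  It is closed under sums and products, contains interval indicators, and each member times an
  absolutely integrable function is again absolutely integrable, so every pairing below makes
  sense.\<close>

definition bdd_meas :: "real set \<Rightarrow> (real \<Rightarrow> real) \<Rightarrow> bool" where
  "bdd_meas S f \<longleftrightarrow> f \<in> borel_measurable (lebesgue_on S) \<and> bounded (f ` S)"

lemma bdd_meas_add [intro]:
  assumes "bdd_meas S f" "bdd_meas S g"
  shows "bdd_meas S (\<lambda>x. f x + g x)"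
  using assms bounded_plus_comp by (auto simp: bdd_meas_def)

lemma bdd_meas_mult [intro]:
  assumes "bdd_meas S f" "bdd_meas S g"
  shows "bdd_meas S (\<lambda>x. f x * g x)"
proof -
  obtain C D where "\<And>x. x \<in> S \<Longrightarrow> \<bar>f x\<bar> \<le> C" "\<And>x. x \<in> S \<Longrightarrow> \<bar>g x\<bar> \<le> D"
    using assms by (auto simp: bdd_meas_def bounded_iff)
  then have "\<bar>f x * g x\<bar> \<le> C * D" if "x \<in> S" for x
    using that mult_mono[of "\<bar>f x\<bar>" C "\<bar>g x\<bar>" D] abs_ge_zero[of "f x"]
    unfolding abs_mult by (meson abs_ge_zero order_trans)
  then have "bounded ((\<lambda>x. f x * g x) ` S)"
    by (auto simp: bounded_iff)
  then show ?thesis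
    using assms by (auto simp: bdd_meas_def)
qed

lemma bdd_meas_const [intro, simp]: "bdd_meas S (\<lambda>x. c)"
  by (auto simp: bdd_meas_def image_constant_conv)

lemma bdd_meas_diff [intro]:
  assumes "bdd_meas S f" "bdd_meas S g"
  shows "bdd_meas S (\<lambda>x. f x - g x)"
  using bdd_meas_add[OF assms(1) bdd_meas_mult[OF bdd_meas_const[of S "-1"] assms(2)]] by simp

lemma bdd_meas_power2 [intro]: "bdd_meas S f \<Longrightarrow> bdd_meas S (\<lambda>x. (f x)\<^sup>2)"
  unfolding power2_eq_square by (rule bdd_meas_mult)

lemma bdd_meas_sum [intro]:
  assumes "\<And>i. i \<in> I \<Longrightarrow> bdd_meas S (f i)"
  shows "bdd_meas S (\<lambda>x. \<Sum>i\<in>I. f i x)"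
  using assms by (induction I rule: infinite_finite_induct) auto

lemma bdd_meas_continuous_on: "continuous_on {a..b} f \<Longrightarrow> bdd_meas {a..b} f"
  by (simp add: bdd_meas_def continuous_imp_measurable_on_sets_lebesgue
      compact_imp_bounded compact_continuous_image)

lemma bdd_meas_indicator [intro]: "bdd_meas {a..b} (indicator {x..y})"
proof -
  have "indicat_real {x..y} \<in> borel_measurable (lebesgue_on {a..b})"
    by (intro measurable_restrict_space1 borel_measurable_indicator) auto
  then show ?thesis
    by (auto simp: bdd_meas_def bounded_iff intro!: exI[of _ 1] simp: indicator_def)
qed

lemma bdd_meas_if_le [intro]: "bdd_meas {a..b} (\<lambda>s. if s \<le> \<tau> then 1 else 0)"
proof -
  have "(\<lambda>s. if s \<le> \<tau> then 1 else 0 :: real) ` {a..b} = indicat_real {a..\<tau>} ` {a..b}"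
    "((\<lambda>s. if s \<le> \<tau> then 1 else 0 :: real) \<in> borel_measurable (lebesgue_on {a..b})) =
     (indicat_real {a..\<tau>} \<in> borel_measurable (lebesgue_on {a..b}))"
    by (intro image_cong refl, simp add: indicator_def)
       (intro measurable_cong, simp add: indicator_def)
  then show ?thesis
    using bdd_meas_indicator[of a b a \<tau>] by (simp add: bdd_meas_def)
qed

lemma bdd_meas_mult_absolutely_integrable:
  assumes "bdd_meas {a..b} f" "g absolutely_integrable_on {a..b}"
  shows "(\<lambda>x. f x * g x) absolutely_integrable_on {a..b}"
  using assms by (intro absolutely_integrable_bounded_measurable_product_real) (auto simp: bdd_meas_def)

lemma bdd_meas_absolutely_integrable:
  assumes "bdd_meas {a..b} f"
  shows "f absolutely_integrable_on {a..b}"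
  using bdd_meas_mult_absolutely_integrable[OF assms absolutely_integrable_continuous_real[of a b "\<lambda>_. 1"]]
  by simp

lemma bdd_meas_integrable: "bdd_meas {a..b} f \<Longrightarrow> f integrable_on {a..b}"
  using bdd_meas_absolutely_integrable absolutely_integrable_on_def by blast

lemma bdd_meas_subset:
  assumes "bdd_meas {a..b} f" "{x..y} \<subseteq> {a..b}"
  shows "bdd_meas {x..y} f"
  using assms measurable_restrict_mono[of f lebesgue "{a..b}" borel "{x..y}"]
    bounded_subset[OF _ image_mono[OF assms(2)]]
  unfolding bdd_meas_def by blast

section \<open>Integration by parts for indefinite integrals\<close>

lemma integral_diff_interval:
  fixes f :: "real \<Rightarrow> real"
  assumes "f integrable_on {a..b}" "a \<le> x" "x \<le> y" "y \<le> b"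
  shows "integral {a..y} f - integral {a..x} f = integral {x..y} f"
proof -
  have "f integrable_on {a..y}"
    using assms(4) by (intro integrable_subinterval_real[OF assms(1)]) auto
  from Henstock_Kurzweil_Integration.integral_combine[OF assms(2,3) this] show ?thesis
    by linarith
qed

lemma norm_integral_le_const:
  fixes f :: "real \<Rightarrow> real"
  assumes "f integrable_on {x..y}" "x \<le> y" "\<And>s. s \<in> {x..y} \<Longrightarrow> norm (f s) \<le> C"
  shows "norm (integral {x..y} f) \<le> C * (y - x)"
  using integral_norm_bound_integral[of f "{x..y}" "\<lambda>_. C"] assms
    integrable_on_const[of "{x..y}" C] by (auto simp: mult.commute)

text \<open>\<open>D\<close> is the defect in the product rule for the two indefinite integrals.
  Neither factor need be differentiable at \<open>z\<close>, so the derivative is obtained from an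
  increment estimate: with \<open>N\<close> the indefinite integral of \<open>\<bar>r\<bar>\<close>,
  the change of \<open>D\<close> over \<open>[x,y]\<close> is at most a constant times
  \<open>(y - x) * (N y - N x)\<close>, and \<open>N\<close> is continuous. Having this at every
  \<open>z\<close> makes \<open>D\<close> constant.\<close>

lemma indefinite_integral_mult_derivative:
  fixes \<psi> r :: "real \<Rightarrow> real"
  assumes \<psi>: "bdd_meas {a..b} \<psi>" and r: "r absolutely_integrable_on {a..b}"
    and z: "z \<in> {a..b}"
  defines "D \<equiv> \<lambda>x. integral {a..x} (\<lambda>s. integral {a..s} \<psi> * r s)
      + integral {a..x} (\<lambda>s. \<psi> s * integral {a..s} r) - integral {a..x} \<psi> * integral {a..x} r"
  shows "(D has_derivative (\<lambda>h. 0)) (at z within {a..b})"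
proof -
  define \<Psi> R N where "\<Psi> = (\<lambda>x. integral {a..x} \<psi>)" and "R = (\<lambda>x. integral {a..x} r)"
    and "N = (\<lambda>x. integral {a..x} (\<lambda>s. \<bar>r s\<bar>))"
  obtain C where C: "\<And>s. s \<in> {a..b} \<Longrightarrow> \<bar>\<psi> s\<bar> \<le> C" and C0: "C \<ge> 0"
    using \<psi> by (force simp: bdd_meas_def bounded_pos)
  have ri: "r integrable_on {a..b}" "(\<lambda>s. \<bar>r s\<bar>) integrable_on {a..b}"
    using r by (auto simp: absolutely_integrable_on_def)
  have \<psi>i: "\<psi> integrable_on {a..b}"
    using \<psi> bdd_meas_integrable by blast
  have contR: "continuous_on {a..b} R" and cont\<Psi>: "continuous_on {a..b} \<Psi>" and contN: "continuous_on {a..b} N"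
    using ri \<psi>i by (auto simp: R_def \<Psi>_def N_def intro: indefinite_integral_continuous_1)
  have i1: "(\<lambda>s. \<Psi> s * r s) integrable_on {a..b}"
    using bdd_meas_mult_absolutely_integrable[OF bdd_meas_continuous_on[OF cont\<Psi>] r]
    by (auto simp: absolutely_integrable_on_def)
  have i2: "(\<lambda>s. \<psi> s * R s) integrable_on {a..b}"
    by (intro bdd_meas_integrable bdd_meas_mult \<psi> bdd_meas_continuous_on contR)
  have le: "\<bar>D y - D x\<bar> \<le> 2 * C * (y - x) * (N y - N x)" if "a \<le> x" "x \<le> y" "y \<le> b" for x y
  proof -
    have sub: "f integrable_on {x..y}" if "f integrable_on {a..b}" for f :: "real \<Rightarrow> real"
      using integrable_subinterval_real[OF that] \<open>a \<le> x\<close> \<open>y \<le> b\<close> by auto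
    have eqs: "integral {x..y} r = R y - R x" "integral {x..y} \<psi> = \<Psi> y - \<Psi> x"
      "integral {x..y} (\<lambda>s. \<bar>r s\<bar>) = N y - N x"
      using integral_diff_interval[OF _ that] ri \<psi>i by (auto simp: R_def \<Psi>_def N_def)
    have "D y - D x = integral {x..y} (\<lambda>s. \<Psi> s * r s) + integral {x..y} (\<lambda>s. \<psi> s * R s)
        - (\<Psi> y * R y - \<Psi> x * R x)"
      using integral_diff_interval[OF i1 that] integral_diff_interval[OF i2 that]
      by (simp add: D_def R_def \<Psi>_def)
    \<comment> \<open>Centring \<open>\<Psi>\<close> at the left end and \<open>R\<close> at the
      right end absorbs the boundary term, and both centred factors are small on a short
      interval.\<close>
    also have "\<dots> = integral {x..y} (\<lambda>s. (\<Psi> s - \<Psi> x) * r s) + integral {x..y} (\<lambda>s. \<psi> s * (R s - R y))"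
      using sub[OF i1] sub[OF i2] sub[OF ri(1)] sub[OF \<psi>i]
      by (simp add: algebra_simps integral_diff integrable_on_mult_right integrable_on_mult_left eqs)
    finally have D: "D y - D x = integral {x..y} (\<lambda>s. (\<Psi> s - \<Psi> x) * r s) + integral {x..y} (\<lambda>s. \<psi> s * (R s - R y))" .
    have "norm (integral {x..y} (\<lambda>s. (\<Psi> s - \<Psi> x) * r s)) \<le> integral {x..y} (\<lambda>s. (C * (y - x)) * \<bar>r s\<bar>)"
    proof (rule integral_norm_bound_integral)
      show "(\<lambda>s. (\<Psi> s - \<Psi> x) * r s) integrable_on {x..y}"
        unfolding left_diff_distrib by (intro integrable_diff sub[OF i1] integrable_on_mult_right sub[OF ri(1)])
      show "(\<lambda>s. (C * (y - x)) * \<bar>r s\<bar>) integrable_on {x..y}"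
        by (intro integrable_on_mult_right sub[OF ri(2)])
      fix s assume s: "s \<in> {x..y}"
      have "\<Psi> s - \<Psi> x = integral {x..s} \<psi>"
        using integral_diff_interval[OF \<psi>i, of x s] s that by (simp add: \<Psi>_def)
      also have "norm \<dots> \<le> C * (s - x)"
        using s that C by (intro norm_integral_le_const integrable_subinterval_real[OF \<psi>i]) auto
      also have "\<dots> \<le> C * (y - x)"
        using s C0 by (intro mult_left_mono) auto
      finally show "norm ((\<Psi> s - \<Psi> x) * r s) \<le> (C * (y - x)) * \<bar>r s\<bar>"
        by (auto simp: abs_mult intro: mult_right_mono)
    qed
    moreover have "norm (integral {x..y} (\<lambda>s. \<psi> s * (R s - R y))) \<le> (C * (N y - N x)) * (y - x)"
    proof (rule norm_integral_le_const)
      show "(\<lambda>s. \<psi> s * (R s - R y)) integrable_on {x..y}"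
        unfolding right_diff_distrib by (intro integrable_diff sub[OF i2] integrable_on_mult_left sub[OF \<psi>i])
      fix s assume s: "s \<in> {x..y}"
      have "R y - R s = integral {s..y} r"
        using integral_diff_interval[OF ri(1), of s y] s that by (simp add: R_def)
      also have "norm \<dots> \<le> integral {s..y} (\<lambda>s. \<bar>r s\<bar>)"
        using s that by (intro integral_norm_bound_integral integrable_subinterval_real[OF ri(1)]
            integrable_subinterval_real[OF ri(2)]) auto
      also have "\<dots> \<le> integral {x..y} (\<lambda>s. \<bar>r s\<bar>)"
        using s that by (intro integral_subset_le integrable_subinterval_real[OF ri(2)]) auto
      finally have "\<bar>R s - R y\<bar> \<le> N y - N x"
        using eqs by simp
      then show "norm (\<psi> s * (R s - R y)) \<le> C * (N y - N x)"
        using C[of s] C0 s that by (auto simp: abs_mult intro!: mult_mono)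
    qed (use that in auto)
    moreover have "2 * C * (y - x) * (N y - N x) = C * (y - x) * (N y - N x) + C * (N y - N x) * (y - x)"
      by (simp add: algebra_simps)
    ultimately show ?thesis
      unfolding D eqs(3)[symmetric] integral_mult_right real_norm_def
      by linarith
  qed
  have le': "\<bar>D y - D z\<bar> \<le> 2 * C * \<bar>y - z\<bar> * \<bar>N y - N z\<bar>" if "y \<in> {a..b}" for y
  proof -
    have *: "2 * C * \<bar>y - z\<bar> * (N y - N z) \<le> 2 * C * \<bar>y - z\<bar> * \<bar>N y - N z\<bar>"
      "2 * C * \<bar>y - z\<bar> * (N z - N y) \<le> 2 * C * \<bar>y - z\<bar> * \<bar>N y - N z\<bar>"
      using C0 by (auto intro!: mult_left_mono)
    show ?thesis
      using le[of z y] le[of y z] that z * by (cases "z \<le> y") (auto simp: abs_minus_commute)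
  qed
  show ?thesis
    unfolding has_derivative_within_alt
  proof (intro conjI allI impI)
    fix e :: real assume "e > 0"
    \<comment> \<open>The \<open>+ 1\<close> keeps the denominator positive when
      \<open>C = 0\<close>.\<close>
    then have "e / (2 * C + 1) > 0"
      using C0 by simp
    then obtain d where "d > 0" and d: "\<And>y. y \<in> {a..b} \<Longrightarrow> \<bar>y - z\<bar> < d \<Longrightarrow> \<bar>N y - N z\<bar> < e / (2 * C + 1)"
      using contN z unfolding continuous_on_iff dist_real_def by metis
    show "\<exists>d>0. \<forall>y\<in>{a..b}. norm (y - z) < d \<longrightarrow> norm (D y - D z - 0) \<le> e * norm (y - z)"
    proof (intro exI[of _ d] conjI ballI impI)
      fix y assume y: "y \<in> {a..b}" "norm (y - z) < d"
      have "2 * C * \<bar>N y - N z\<bar> \<le> (2 * C + 1) * (e / (2 * C + 1))"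
        using d[of y] y C0 by (intro mult_mono) (auto intro: less_imp_le)
      also have "\<dots> = e"
        using C0 by simp
      finally have "2 * C * \<bar>N y - N z\<bar> * \<bar>y - z\<bar> \<le> e * \<bar>y - z\<bar>"
        by (rule mult_right_mono) simp
      then show "norm (D y - D z - 0) \<le> e * norm (y - z)"
        using le'[OF y(1)] by (simp add: mult_ac)
    qed (fact \<open>d > 0\<close>)
  qed (simp add: bounded_linear_zero)
qed

text \<open>Integration by parts where neither factor needs to be differentiable everywhere.\<close>
lemma integral_indefinite_integral_mult:
  fixes \<psi> r :: "real \<Rightarrow> real"
  assumes "a \<le> b" and \<psi>: "bdd_meas {a..b} \<psi>" and r: "r absolutely_integrable_on {a..b}"
  shows "integral {a..b} (\<lambda>s. integral {a..s} \<psi> * r s) = integral {a..b} (\<lambda>s. \<psi> s * integral {s..b} r)"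
proof -
  define R where "R = (\<lambda>x. integral {a..x} r)"
  have ri: "r integrable_on {a..b}" and \<psi>i: "\<psi> integrable_on {a..b}"
    using r \<psi> bdd_meas_integrable by (auto simp: absolutely_integrable_on_def)
  have "continuous_on {a..b} R"
    using ri by (auto simp: R_def intro: indefinite_integral_continuous_1)
  then have i2: "(\<lambda>s. \<psi> s * R s) integrable_on {a..b}"
    by (intro bdd_meas_integrable bdd_meas_mult \<psi> bdd_meas_continuous_on)
  define D where "D = (\<lambda>x. integral {a..x} (\<lambda>s. integral {a..s} \<psi> * r s)
      + integral {a..x} (\<lambda>s. \<psi> s * R s) - integral {a..x} \<psi> * R x)"
  have "\<exists>c. \<forall>x\<in>{a..b}. D x = c"
    unfolding D_def R_def
    by (rule has_derivative_zero_constant) (auto intro!: indefinite_integral_mult_derivative[OF \<psi> r])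
  then have "D b = D a"
    using \<open>a \<le> b\<close> by auto
  then have "integral {a..b} (\<lambda>s. integral {a..s} \<psi> * r s) + integral {a..b} (\<lambda>s. \<psi> s * R s)
      - integral {a..b} \<psi> * R b = 0"
    by (simp add: D_def)
  moreover have "integral {a..b} (\<lambda>s. \<psi> s * integral {s..b} r) = integral {a..b} (\<lambda>s. \<psi> s * R b - \<psi> s * R s)"
    by (intro integral_cong) (use integral_diff_interval[OF ri] in \<open>auto simp: R_def right_diff_distrib[symmetric]\<close>)
  ultimately show ?thesis
    using i2 integrable_on_mult_left[OF \<psi>i, of "R b"] by (simp add: integral_diff)
qed

section \<open>Lagrange multipliers for finitely many linear constraints\<close>

text \<open>Induction on the number of constraints. \<open>cmb x c y\<close> stands for
  \<open>x + c y\<close>; vector space structure is replaced by closure of the set \<open>V\<close>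
  under this operation, so that the lemma applies directly to a set of functions.\<close>

lemma kernel_subset_imp_linear_combination:
  fixes F :: "'i \<Rightarrow> 'v \<Rightarrow> real" and H :: "'v \<Rightarrow> real" and cmb :: "'v \<Rightarrow> real \<Rightarrow> 'v \<Rightarrow> 'v"
  assumes "finite I" and V: "\<And>x y c. x \<in> V \<Longrightarrow> y \<in> V \<Longrightarrow> cmb x c y \<in> V"
    and F: "\<And>i x y c. i \<in> I \<Longrightarrow> x \<in> V \<Longrightarrow> y \<in> V \<Longrightarrow> F i (cmb x c y) = F i x + c * F i y"
    and H: "\<And>x y c. x \<in> V \<Longrightarrow> y \<in> V \<Longrightarrow> H (cmb x c y) = H x + c * H y"
    and ker: "\<And>x. x \<in> V \<Longrightarrow> (\<And>i. i \<in> I \<Longrightarrow> F i x = 0) \<Longrightarrow> H x = 0"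
  shows "\<exists>c. \<forall>x\<in>V. H x = (\<Sum>i\<in>I. c i * F i x)"
  using \<open>finite I\<close> F H ker
proof (induction I arbitrary: H rule: finite_induct)
  case empty
  then show ?case by auto
next
  case (insert j I)
  note F = insert.prems(1) and H = insert.prems(2) and ker = insert.prems(3)
  show ?case
  proof (cases "\<exists>e\<in>V. (\<forall>i\<in>I. F i e = 0) \<and> F j e \<noteq> 0")
    case True
    then obtain e where e: "e \<in> V" "\<And>i. i \<in> I \<Longrightarrow> F i e = 0" "F j e \<noteq> 0"
      by blast
    \<comment> \<open>The vector \<open>e\<close> isolates the constraint \<open>j\<close>, so
      evaluating at \<open>e\<close> forces the value of its multiplier. Once \<open>h * F j\<close>
      is subtracted, the remaining constraints suffice: any \<open>x\<close> in their kernel can be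
      moved along \<open>e\<close> until \<open>F j\<close> vanishes too.\<close>
    define h where "h = H e / F j e"
    have "\<exists>c. \<forall>x\<in>V. H x - h * F j x = (\<Sum>i\<in>I. c i * F i x)"
    proof (rule insert.IH)
      fix x assume x: "x \<in> V" "\<And>i. i \<in> I \<Longrightarrow> F i x = 0"
      have "H (cmb x (- (F j x / F j e)) e) = 0"
        using x e by (intro ker V) (auto simp: F)
      then show "H x - h * F j x = 0"
        using x e by (simp add: H h_def)
    qed (auto simp: F H algebra_simps)
    then obtain c where c: "\<And>x. x \<in> V \<Longrightarrow> H x - h * F j x = (\<Sum>i\<in>I. c i * F i x)"
      by blast
    have "(\<Sum>i\<in>I. (c(j := h)) i * F i x) = (\<Sum>i\<in>I. c i * F i x)" for x
      using insert.hyps by (intro sum.cong) auto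
    then have "\<forall>x\<in>V. H x = (\<Sum>i\<in>insert j I. (c(j := h)) i * F i x)"
      using insert.hyps c by (auto simp: algebra_simps)
    then show ?thesis by blast
  next
    \<comment> \<open>Here \<open>F j\<close> already vanishes on the common kernel of the others,
      so it receives the multiplier \<open>0\<close>.\<close>
    case False
    have "\<exists>c. \<forall>x\<in>V. H x = (\<Sum>i\<in>I. c i * F i x)"
    proof (rule insert.IH)
      fix x assume x: "x \<in> V" "\<And>i. i \<in> I \<Longrightarrow> F i x = 0"
      then have "F j x = 0"
        using False by blast
      then show "H x = 0"
        using x by (intro ker) auto
    qed (use F H in auto)
    then obtain c where c: "\<And>x. x \<in> V \<Longrightarrow> H x = (\<Sum>i\<in>I. c i * F i x)"
      by blast
    have "(\<Sum>i\<in>I. (c(j := 0)) i * F i x) = (\<Sum>i\<in>I. c i * F i x)" for x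
      using insert.hyps by (intro sum.cong) auto
    then have "\<forall>x\<in>V. H x = (\<Sum>i\<in>insert j I. (c(j := 0)) i * F i x)"
      using insert.hyps c by auto
    then show ?thesis by blast
  qed
qed

lemma integral_mult_if_le:
  fixes f :: "real \<Rightarrow> real"
  assumes "\<tau> \<le> b"
  shows "integral {a..b} (\<lambda>s. f s * (if s \<le> \<tau> then 1 else 0)) = integral {a..\<tau>} f"
proof -
  have "integral {a..b} (\<lambda>s. f s * (if s \<le> \<tau> then 1 else 0)) = integral {a..b} (\<lambda>s. if s \<in> {..\<tau>} then f s else 0)"
    by (intro integral_cong) auto
  also have "\<dots> = integral ({..\<tau>} \<inter> {a..b}) f"
    by (rule integral_restrict_Int)
  also have "{..\<tau>} \<inter> {a..b} = {a..\<tau>}"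
    using assms by auto
  finally show ?thesis .
qed

lemma integral_indicator_mult:
  fixes f :: "real \<Rightarrow> real"
  assumes "a \<le> x" "y \<le> b"
  shows "integral {a..b} (\<lambda>s. indicator {x..y} s * f s) = integral {x..y} f"
proof -
  have "integral {a..b} (\<lambda>s. indicator {x..y} s * f s) = integral {a..b} (\<lambda>s. if s \<in> {x..y} then f s else 0)"
    by (intro integral_cong) (auto simp: indicator_def)
  also have "\<dots> = integral ({x..y} \<inter> {a..b}) f"
    by (rule integral_restrict_Int)
  also have "{x..y} \<inter> {a..b} = {x..y}"
    using assms by auto
  finally show ?thesis .
qed

lemma bdd_meas_indefinite_integral:
  "f integrable_on {a..b} \<Longrightarrow> bdd_meas {a..b} (\<lambda>s. integral {a..s} f)"
  by (intro bdd_meas_continuous_on indefinite_integral_continuous_1)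

lemma bdd_meas_positive_part: "bdd_meas {a..b} (\<lambda>s. max 0 (\<tau> - s))"
  by (intro bdd_meas_continuous_on continuous_intros)

text \<open>Integration by parts on \<open>[a,\<tau>]\<close> against the constant \<open>1\<close>,
  whose integral from \<open>s\<close> to \<open>\<tau>\<close> is \<open>\<tau> - s\<close>. It
  turns a constraint on the value of the test function at \<open>\<tau>\<close> into a pairing of
  \<open>\<psi>\<close> with a fixed kernel.\<close>

lemma double_integral_eq_positive_part:
  assumes \<psi>: "bdd_meas {a..b} \<psi>" and \<tau>: "\<tau> \<in> {a..b}"
  shows "integral {a..\<tau>} (\<lambda>s. integral {a..s} \<psi>) = integral {a..b} (\<lambda>s. \<psi> s * max 0 (\<tau> - s))"
proof -
  have "bdd_meas {a..\<tau>} \<psi>"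
    using \<psi> \<tau> by (intro bdd_meas_subset[OF \<psi>]) auto
  then have "integral {a..\<tau>} (\<lambda>s. integral {a..s} \<psi> * 1) = integral {a..\<tau>} (\<lambda>s. \<psi> s * integral {s..\<tau>} (\<lambda>_. 1))"
    using \<tau> by (intro integral_indefinite_integral_mult absolutely_integrable_continuous_real) auto
  also have "\<dots> = integral {a..\<tau>} (\<lambda>s. \<psi> s * max 0 (\<tau> - s))"
    by (intro integral_cong) auto
  also have "\<dots> = integral {a..b} (\<lambda>s. \<psi> s * max 0 (\<tau> - s) * (if s \<le> \<tau> then 1 else 0))"
    using \<tau> by (intro integral_mult_if_le[symmetric]) auto
  also have "\<dots> = integral {a..b} (\<lambda>s. \<psi> s * max 0 (\<tau> - s))"
    by (intro integral_cong) auto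
  finally show ?thesis by simp
qed

text \<open>The summands with coefficients \<open>c\<close> and \<open>d\<close> are the Lagrange multipliers of the
  constraints on the value and the derivative of the test function \<open>\<integral>\<integral>\<psi>\<close>.\<close>
lemma weak_equation_multipliers:
  fixes r :: "real \<Rightarrow> real" and \<kappa> l :: real
  assumes "a \<le> b" and r: "r absolutely_integrable_on {a..b}"
    and fin: "finite N" "finite N'" and sub: "N \<subseteq> {a..b}" "N' \<subseteq> {a..b}"
    and weak: "\<And>\<psi>. \<lbrakk>bdd_meas {a..b} \<psi>; \<And>\<tau>. \<tau> \<in> N \<Longrightarrow> integral {a..\<tau>} (\<lambda>s. integral {a..s} \<psi>) = 0;
        \<And>\<tau>. \<tau> \<in> N' \<Longrightarrow> integral {a..\<tau>} \<psi> = 0\<rbrakk> \<Longrightarrow>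
      integral {a..b} (\<lambda>s. (\<psi> s + \<kappa> * integral {a..s} \<psi> + l * integral {a..s} (\<lambda>s. integral {a..s} \<psi>)) * r s) = 0"
  shows "\<exists>c d. \<forall>x y. a \<le> x \<and> x \<le> y \<and> y \<le> b \<longrightarrow> integral {x..y} r = integral {x..y}
    (\<lambda>s. (\<Sum>\<tau>\<in>N. c \<tau> * max 0 (\<tau> - s)) + (\<Sum>\<tau>\<in>N'. d \<tau> * (if s \<le> \<tau> then 1 else 0))
        - \<kappa> * integral {s..b} r - l * integral {s..b} (\<lambda>s. integral {s..b} r))"
proof -
  define P where "P = (\<lambda>s. integral {s..b} r)"
  define Q where "Q = (\<lambda>s. integral {s..b} (\<lambda>s. P s))"
  define h where "h = (\<lambda>s. r s + \<kappa> * P s + l * Q s)"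
  \<comment> \<open>A disjoint sum indexes the kernels because the same node may carry both a value
    constraint (\<open>Inl\<close>) and a derivative constraint (\<open>Inr\<close>).\<close>
  define k :: "real + real \<Rightarrow> real \<Rightarrow> real" where
    "k = case_sum (\<lambda>\<tau> s. max 0 (\<tau> - s)) (\<lambda>\<tau> s. if s \<le> \<tau> then 1 else 0)"
  have ri: "r integrable_on {a..b}"
    using r by (auto simp: absolutely_integrable_on_def)
  have contP: "continuous_on {a..b} (\<lambda>s. P s)"
    unfolding P_def by (rule indefinite_integral_continuous_1'[OF ri])
  then have contQ: "continuous_on {a..b} Q"
    unfolding Q_def by (intro indefinite_integral_continuous_1' integrable_continuous_real)
  have bP: "bdd_meas {a..b} (\<lambda>s. P s)" and bQ: "bdd_meas {a..b} Q"
    using contP contQ by (auto intro: bdd_meas_continuous_on)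
  have int_r: "(\<lambda>s. \<psi> s * r s) integrable_on {a..b}" if "bdd_meas {a..b} \<psi>" for \<psi>
    using bdd_meas_mult_absolutely_integrable[OF that r] by (auto simp: absolutely_integrable_on_def)
  have int_b: "(\<lambda>s. \<psi> s * f s) integrable_on {a..b}" if "bdd_meas {a..b} \<psi>" "bdd_meas {a..b} f" for \<psi> f
    using that by (intro bdd_meas_integrable bdd_meas_mult)
  have h_int: "(\<lambda>s. \<psi> s * h s) integrable_on {a..b}" if "bdd_meas {a..b} \<psi>" for \<psi>
  proof -
    have "(\<lambda>s. \<psi> s * r s + \<psi> s * (\<kappa> * P s + l * Q s)) integrable_on {a..b}"
      by (intro integrable_add int_r int_b that bdd_meas_add bdd_meas_mult bdd_meas_const bP bQ)
    then show ?thesis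
      by (simp add: h_def algebra_simps)
  qed
  \<comment> \<open>Passage to the adjoint: one integration by parts turns the pairing of the single
    integral of \<open>\<psi>\<close> with \<open>r\<close> into one of \<open>\<psi>\<close> with
    \<open>P\<close>. The double integral needs two, the second with \<open>P\<close> in the role of
    \<open>r\<close>, and produces \<open>Q\<close>.\<close>
  have H_eq: "integral {a..b} (\<lambda>s. \<psi> s * h s) = integral {a..b} (\<lambda>s. (\<psi> s + \<kappa> * integral {a..s} \<psi> + l * integral {a..s} (\<lambda>s. integral {a..s} \<psi>)) * r s)"
    if \<psi>: "bdd_meas {a..b} \<psi>" for \<psi>
  proof -
    define \<Psi> \<Psi>2 where "\<Psi> = (\<lambda>s. integral {a..s} \<psi>)" and "\<Psi>2 = (\<lambda>s. integral {a..s} \<Psi>)"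
    have b\<Psi>: "bdd_meas {a..b} \<Psi>"
      unfolding \<Psi>_def by (intro bdd_meas_indefinite_integral bdd_meas_integrable \<psi>)
    then have b\<Psi>2: "bdd_meas {a..b} \<Psi>2"
      unfolding \<Psi>2_def by (intro bdd_meas_indefinite_integral bdd_meas_integrable)
    have 1: "integral {a..b} (\<lambda>s. \<Psi> s * r s) = integral {a..b} (\<lambda>s. \<psi> s * P s)"
      unfolding \<Psi>_def P_def using \<open>a \<le> b\<close> \<psi> r by (rule integral_indefinite_integral_mult)
    have "integral {a..b} (\<lambda>s. \<Psi>2 s * r s) = integral {a..b} (\<lambda>s. \<Psi> s * P s)"
      unfolding \<Psi>2_def P_def using \<open>a \<le> b\<close> b\<Psi> r by (rule integral_indefinite_integral_mult)
    also have "\<dots> = integral {a..b} (\<lambda>s. \<psi> s * Q s)"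
      unfolding \<Psi>_def Q_def using \<open>a \<le> b\<close> \<psi> bdd_meas_absolutely_integrable[OF bP]
      by (rule integral_indefinite_integral_mult)
    finally have 2: "integral {a..b} (\<lambda>s. \<Psi>2 s * r s) = integral {a..b} (\<lambda>s. \<psi> s * Q s)" .
    have "integral {a..b} (\<lambda>s. (\<psi> s + \<kappa> * \<Psi> s + l * \<Psi>2 s) * r s)
        = integral {a..b} (\<lambda>s. \<psi> s * r s + (\<kappa> * (\<Psi> s * r s) + l * (\<Psi>2 s * r s)))"
      by (intro integral_cong) (simp add: algebra_simps)
    also have "\<dots> = integral {a..b} (\<lambda>s. \<psi> s * r s) + (\<kappa> * integral {a..b} (\<lambda>s. \<Psi> s * r s) + l * integral {a..b} (\<lambda>s. \<Psi>2 s * r s))"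
      using int_r[OF \<psi>] int_r[OF b\<Psi>] int_r[OF b\<Psi>2]
      by (simp add: integral_add integrable_add integrable_on_mult_right)
    also have "\<dots> = integral {a..b} (\<lambda>s. \<psi> s * r s + (\<kappa> * (\<psi> s * P s) + l * (\<psi> s * Q s)))"
      unfolding 1 2 using int_r[OF \<psi>] int_b[OF \<psi> bP] int_b[OF \<psi> bQ]
      by (simp add: integral_add integrable_add integrable_on_mult_right)
    also have "\<dots> = integral {a..b} (\<lambda>s. \<psi> s * h s)"
      by (intro integral_cong) (simp add: h_def algebra_simps)
    finally show ?thesis
      by (simp add: \<Psi>_def \<Psi>2_def)
  qed
  have bk: "bdd_meas {a..b} (k i)" for i
    by (cases i) (auto simp: k_def bdd_meas_positive_part)
  have "\<exists>c. \<forall>\<psi>\<in>Collect (bdd_meas {a..b}). integral {a..b} (\<lambda>s. \<psi> s * h s)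
      = (\<Sum>i\<in>N <+> N'. c i * integral {a..b} (\<lambda>s. \<psi> s * k i s))"
  proof (rule kernel_subset_imp_linear_combination[where cmb = "\<lambda>\<psi> c \<xi> s. \<psi> s + c * \<xi> s"])
    show "finite (N <+> N')"
      using fin by simp
    fix \<psi> \<xi> :: "real \<Rightarrow> real" and c :: real
    assume \<psi>: "\<psi> \<in> Collect (bdd_meas {a..b})" and \<xi>: "\<xi> \<in> Collect (bdd_meas {a..b})"
    have lin: "integral {a..b} (\<lambda>s. (\<psi> s + c * \<xi> s) * f s) = integral {a..b} (\<lambda>s. \<psi> s * f s) + c * integral {a..b} (\<lambda>s. \<xi> s * f s)"
      if "(\<lambda>s. \<psi> s * f s) integrable_on {a..b}" "(\<lambda>s. \<xi> s * f s) integrable_on {a..b}" for f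
      using that by (simp add: distrib_right mult.assoc integral_add integrable_on_mult_right)
    show "(\<lambda>s. \<psi> s + c * \<xi> s) \<in> Collect (bdd_meas {a..b})"
      using \<psi> \<xi> by (simp add: bdd_meas_add bdd_meas_mult)
    show "integral {a..b} (\<lambda>s. (\<psi> s + c * \<xi> s) * h s) = integral {a..b} (\<lambda>s. \<psi> s * h s) + c * integral {a..b} (\<lambda>s. \<xi> s * h s)"
      using \<psi> \<xi> by (intro lin h_int) auto
    show "integral {a..b} (\<lambda>s. (\<psi> s + c * \<xi> s) * k i s) = integral {a..b} (\<lambda>s. \<psi> s * k i s) + c * integral {a..b} (\<lambda>s. \<xi> s * k i s)" for i
      using \<psi> \<xi> bk by (intro lin int_b) auto
  next
    fix \<psi> assume "\<psi> \<in> Collect (bdd_meas {a..b})"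
      and ker: "\<And>i. i \<in> N <+> N' \<Longrightarrow> integral {a..b} (\<lambda>s. \<psi> s * k i s) = 0"
    then have \<psi>: "bdd_meas {a..b} \<psi>" by simp
    show "integral {a..b} (\<lambda>s. \<psi> s * h s) = 0"
      unfolding H_eq[OF \<psi>]
    proof (rule weak[OF \<psi>])
      fix \<tau> assume "\<tau> \<in> N"
      then show "integral {a..\<tau>} (\<lambda>s. integral {a..s} \<psi>) = 0"
        using ker[OF InlI[of \<tau>]] double_integral_eq_positive_part[OF \<psi> subsetD[OF sub(1)], of \<tau>]
        by (simp add: k_def)
    next
      fix \<tau> assume "\<tau> \<in> N'"
      then show "integral {a..\<tau>} \<psi> = 0"
        using ker[OF InrI[of \<tau>]] subsetD[OF sub(2), of \<tau>] integral_mult_if_le[of \<tau> b a \<psi>]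
        by (simp add: k_def)
    qed
  qed
  then obtain c where c: "\<And>\<psi>. bdd_meas {a..b} \<psi> \<Longrightarrow> integral {a..b} (\<lambda>s. \<psi> s * h s)
      = (\<Sum>i\<in>N <+> N'. c i * integral {a..b} (\<lambda>s. \<psi> s * k i s))"
    by auto
  show ?thesis
  proof (rule exI[of _ "\<lambda>\<tau>. c (Inl \<tau>)"], rule exI[of _ "\<lambda>\<tau>. c (Inr \<tau>)"], intro allI impI)
    fix x y assume xy: "a \<le> x \<and> x \<le> y \<and> y \<le> b"
    have sub': "f integrable_on {x..y}" if "f integrable_on {a..b}" for f :: "real \<Rightarrow> real"
      using integrable_subinterval_real[OF that, of x y] xy by auto
    have kxy: "(\<lambda>s. k i s) integrable_on {x..y}" for i
      using bdd_meas_integrable[OF bk] by (rule sub')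
    have Pxy: "(\<lambda>s. \<kappa> * P s + l * Q s) integrable_on {x..y}"
      by (intro sub' bdd_meas_integrable bdd_meas_add bdd_meas_mult bdd_meas_const bP bQ)
    \<comment> \<open>Taking the indicator of \<open>[x,y]\<close> as \<open>\<psi>\<close>
      localizes the identity. Equality of integrals over all subintervals takes the place of
      equality almost everywhere.\<close>
    have "integral {x..y} h = (\<Sum>i\<in>N <+> N'. c i * integral {x..y} (k i))"
      using c[OF bdd_meas_indicator, of x y] xy by (simp add: integral_indicator_mult)
    also have "\<dots> = integral {x..y} (\<lambda>s. \<Sum>i\<in>N <+> N'. c i * k i s)"
      using fin kxy by (subst integral_sum) (auto intro: integrable_on_mult_right)
    finally have "integral {x..y} (\<lambda>s. r s + (\<kappa> * P s + l * Q s)) = integral {x..y} (\<lambda>s. \<Sum>i\<in>N <+> N'. c i * k i s)"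
      by (simp add: h_def add.assoc)
    then have "integral {x..y} r = integral {x..y} (\<lambda>s. \<Sum>i\<in>N <+> N'. c i * k i s) - integral {x..y} (\<lambda>s. \<kappa> * P s + l * Q s)"
      using sub'[OF ri] Pxy by (simp add: integral_add)
    also have "\<dots> = integral {x..y} (\<lambda>s. (\<Sum>i\<in>N <+> N'. c i * k i s) - (\<kappa> * P s + l * Q s))"
      using fin kxy Pxy by (intro integral_diff[symmetric] integrable_sum integrable_on_mult_right) auto
    finally show "integral {x..y} r = integral {x..y}
        (\<lambda>s. (\<Sum>\<tau>\<in>N. c (Inl \<tau>) * max 0 (\<tau> - s)) + (\<Sum>\<tau>\<in>N'. c (Inr \<tau>) * (if s \<le> \<tau> then 1 else 0))
          - \<kappa> * integral {s..b} r - l * integral {s..b} (\<lambda>s. integral {s..b} r))"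
      using fin by (simp add: sum.Plus k_def P_def Q_def diff_diff_eq)
  qed
qed

section \<open>Regularity of solutions of the weak equation\<close>

lemma if_le_has_real_derivative_0:
  fixes s \<tau> :: real
  assumes "s \<noteq> \<tau>"
  shows "((\<lambda>s. if s \<le> \<tau> then 1 else 0) has_real_derivative 0) (at s)"
proof (rule has_field_derivative_transform_within_open)
  show "((\<lambda>_. if s \<le> \<tau> then 1 else 0) has_real_derivative 0) (at s)"
    by simp
  show "open (if s \<le> \<tau> then {..<\<tau>} else {\<tau><..})"
    by simp
qed (use assms in \<open>auto split: if_splits\<close>)

lemma positive_part_has_real_derivative:
  fixes s \<tau> :: real
  assumes "s \<noteq> \<tau>"
  shows "((\<lambda>s. max 0 (\<tau> - s)) has_real_derivative - (if s \<le> \<tau> then 1 else 0)) (at s)"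
proof (rule has_field_derivative_transform_within_open)
  show "((\<lambda>x. if s \<le> \<tau> then \<tau> - x else 0) has_real_derivative - (if s \<le> \<tau> then 1 else 0)) (at s)"
    by (auto intro!: derivative_eq_intros)
  show "open (if s \<le> \<tau> then {..<\<tau>} else {\<tau><..})"
    by simp
qed (use assms in \<open>auto split: if_splits\<close>)

lemma integral_has_real_derivative_at:
  fixes f :: "real \<Rightarrow> real"
  assumes "f integrable_on {a..b}" "s \<in> {a<..<b}" "isCont f s"
  shows "((\<lambda>x. integral {a..x} f) has_real_derivative f s) (at s)"
proof -
  have "((\<lambda>x. integral {a..x} f) has_vector_derivative f s) (at s within {a..b} - {})"
  proof (rule integral_has_vector_derivative_continuous_at[OF assms(1)])
    show "continuous (at s within {a..b} - {}) f"
      using assms(3) by (rule continuous_at_imp_continuous_at_within)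
  qed (use assms(2) in auto)
  moreover have "at s within {a..b} = at s"
    using assms by (intro at_within_interior) auto
  ultimately show ?thesis
    by (simp add: has_real_derivative_iff_has_vector_derivative)
qed

lemma integral_lower_has_real_derivative_at:
  fixes f :: "real \<Rightarrow> real"
  assumes f: "f integrable_on {a..b}" and s: "s \<in> {a<..<b}"
    and deriv: "((\<lambda>x. integral {a..x} f) has_real_derivative D) (at s)"
  shows "((\<lambda>x. integral {x..b} f) has_real_derivative - D) (at s)"
proof (rule has_field_derivative_transform_within_open)
  show "((\<lambda>x. integral {a..b} f - integral {a..x} f) has_real_derivative - D) (at s)"
    by (rule derivative_eq_intros deriv refl | simp)+
  fix x assume "x \<in> {a<..<b}"
  then show "integral {a..b} f - integral {a..x} f = integral {x..b} f"
    using integral_diff_interval[OF f, of x b] by auto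
qed (use s in auto)

text \<open>Bootstrapping: \<open>\<rho>\<close> is the right-hand side of the multiplier identity,
  a version of \<open>r\<close> with the same integrals. Away from \<open>N'\<close> it is
  continuous, hence the derivative of the integral of \<open>r\<close>. Away from all nodes its
  ingredients \<open>P\<close> and \<open>Q\<close> are differentiable, which makes
  \<open>\<rho>\<close> differentiable, and one more round applies to
  \<open>\<sigma>\<close>.\<close>

lemma weak_equation_regularity:
  fixes r :: "real \<Rightarrow> real" and \<kappa> l :: real
  assumes "a \<le> b" and r: "r absolutely_integrable_on {a..b}"
    and fin: "finite N" "finite N'" and sub: "N \<subseteq> {a..b}" "N' \<subseteq> {a..b}"
    and weak: "\<And>\<psi>. \<lbrakk>bdd_meas {a..b} \<psi>; \<And>\<tau>. \<tau> \<in> N \<Longrightarrow> integral {a..\<tau>} (\<lambda>s. integral {a..s} \<psi>) = 0;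
        \<And>\<tau>. \<tau> \<in> N' \<Longrightarrow> integral {a..\<tau>} \<psi> = 0\<rbrakk> \<Longrightarrow>
      integral {a..b} (\<lambda>s. (\<psi> s + \<kappa> * integral {a..s} \<psi> + l * integral {a..s} (\<lambda>s. integral {a..s} \<psi>)) * r s) = 0"
  obtains \<rho> \<sigma> where "\<And>s. s \<in> {a<..<b} - N' \<Longrightarrow> ((\<lambda>x. integral {a..x} r) has_real_derivative \<rho> s) (at s)"
    and "\<And>s. s \<in> {a<..<b} - N - N' \<Longrightarrow> (\<rho> has_real_derivative \<sigma> s) (at s)"
    and "\<And>s. s \<in> {a<..<b} - N - N' \<Longrightarrow> (\<sigma> has_real_derivative \<kappa> * \<sigma> s - l * \<rho> s) (at s)"
proof -
  define P where "P = (\<lambda>s. integral {s..b} r)"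
  define Q where "Q = (\<lambda>s. integral {s..b} P)"
  obtain c d where cd: "\<And>x y. a \<le> x \<Longrightarrow> x \<le> y \<Longrightarrow> y \<le> b \<Longrightarrow> integral {x..y} r = integral {x..y}
    (\<lambda>s. (\<Sum>\<tau>\<in>N. c \<tau> * max 0 (\<tau> - s)) + (\<Sum>\<tau>\<in>N'. d \<tau> * (if s \<le> \<tau> then 1 else 0)) - \<kappa> * P s - l * Q s)"
    using weak_equation_multipliers[OF assms] unfolding P_def Q_def by blast
  define \<rho> where "\<rho> = (\<lambda>s. (\<Sum>\<tau>\<in>N. c \<tau> * max 0 (\<tau> - s)) + (\<Sum>\<tau>\<in>N'. d \<tau> * (if s \<le> \<tau> then 1 else 0)) - \<kappa> * P s - l * Q s)"
  \<comment> \<open>This is \<open>\<rho>\<close> differentiated formally: each positive part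
    contributes minus a step, the steps at \<open>N'\<close> contribute \<open>0\<close>, and
    \<open>P' = -\<rho>\<close>, \<open>Q' = -P\<close>.\<close>
  define \<sigma> where "\<sigma> = (\<lambda>s. - (\<Sum>\<tau>\<in>N. c \<tau> * (if s \<le> \<tau> then 1 else 0)) + \<kappa> * \<rho> s + l * P s)"
  have ri: "r integrable_on {a..b}"
    using r by (auto simp: absolutely_integrable_on_def)
  have contP: "continuous_on {a..b} P"
    unfolding P_def by (rule indefinite_integral_continuous_1'[OF ri])
  then have Pi: "P integrable_on {a..b}"
    by (rule integrable_continuous_real)
  then have contQ: "continuous_on {a..b} Q"
    unfolding Q_def by (rule indefinite_integral_continuous_1')
  have "bdd_meas {a..b} \<rho>"
    unfolding \<rho>_def by (intro bdd_meas_diff bdd_meas_add bdd_meas_sum bdd_meas_mult bdd_meas_const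
        bdd_meas_positive_part bdd_meas_if_le bdd_meas_continuous_on contP contQ)
  then have \<rho>i: "\<rho> integrable_on {a..b}"
    by (rule bdd_meas_integrable)
  have cont: "isCont P s" "isCont Q s" if "s \<in> {a<..<b}" for s
    using that contP contQ by (auto intro: continuous_on_interior)
  have R': "((\<lambda>x. integral {a..x} r) has_real_derivative \<rho> s) (at s)" if s: "s \<in> {a<..<b} - N'" for s
  proof (rule has_field_derivative_transform_within_open)
    \<comment> \<open>Only the steps at \<open>N'\<close> can jump, since the positive parts are
      continuous even at their own nodes. This is where a node without prescribed velocity gains its
      second derivative.\<close>
    have "isCont (\<lambda>s. if s \<le> \<tau> then 1 else 0 :: real) s" if "\<tau> \<in> N'" for \<tau>
      using s that by (intro DERIV_isCont[OF if_le_has_real_derivative_0]) auto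
    then have "isCont \<rho> s"
      unfolding \<rho>_def using s cont by (intro continuous_intros) auto
    then show "((\<lambda>x. integral {a..x} \<rho>) has_real_derivative \<rho> s) (at s)"
      using s \<rho>i by (intro integral_has_real_derivative_at) auto
    fix x assume "x \<in> {a<..<b}"
    then show "integral {a..x} \<rho> = integral {a..x} r"
      using cd[of a x] by (simp add: \<rho>_def)
  qed (use s in auto)
  have P': "(P has_real_derivative - \<rho> s) (at s)" if "s \<in> {a<..<b} - N - N'" for s
    unfolding P_def using that by (intro integral_lower_has_real_derivative_at[OF ri] R') auto
  have Q': "(Q has_real_derivative - P s) (at s)" if "s \<in> {a<..<b} - N - N'" for s
    unfolding Q_def using that cont
    by (intro integral_lower_has_real_derivative_at[OF Pi] integral_has_real_derivative_at[OF Pi]) auto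
  have \<rho>': "(\<rho> has_real_derivative \<sigma> s) (at s)" if s: "s \<in> {a<..<b} - N - N'" for s
  proof -
    have "(\<rho> has_real_derivative (\<Sum>\<tau>\<in>N. c \<tau> * - (if s \<le> \<tau> then 1 else 0)) + (\<Sum>\<tau>\<in>N'. d \<tau> * 0)
        - \<kappa> * (- \<rho> s) - l * (- P s)) (at s)"
      unfolding \<rho>_def using s
      by (intro DERIV_diff DERIV_add DERIV_sum DERIV_cmult P'[unfolded \<rho>_def] Q'
          positive_part_has_real_derivative if_le_has_real_derivative_0) auto
    also have "(\<Sum>\<tau>\<in>N. c \<tau> * - (if s \<le> \<tau> then 1 else 0)) + (\<Sum>\<tau>\<in>N'. d \<tau> * 0) - \<kappa> * (- \<rho> s) - l * (- P s) = \<sigma> s"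
      by (simp add: \<sigma>_def sum_negf)
    finally show ?thesis .
  qed
  have \<sigma>': "(\<sigma> has_real_derivative \<kappa> * \<sigma> s - l * \<rho> s) (at s)" if s: "s \<in> {a<..<b} - N - N'" for s
  proof -
    \<comment> \<open>Off \<open>N\<close> the steps in \<open>\<sigma>\<close> are locally
      constant, so the multipliers drop out and a homogeneous second-order equation for
      \<open>\<rho>\<close> remains.\<close>
    have "(\<sigma> has_real_derivative - (\<Sum>\<tau>\<in>N. c \<tau> * 0) + \<kappa> * \<sigma> s + l * (- \<rho> s)) (at s)"
      unfolding \<sigma>_def using s
      by (intro DERIV_minus DERIV_add DERIV_sum DERIV_cmult P' \<rho>'[unfolded \<sigma>_def]
          if_le_has_real_derivative_0) auto
    then show ?thesis by simp
  qed
  show ?thesis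
    by (rule that[OF R' \<rho>' \<sigma>'])
qed

section \<open>Smoothness of solutions of the fourth-order equation\<close>

text \<open>The derivatives of all orders of a solution of
  \<open>y'''' + p y'' + q y + e = 0\<close>, as functions of its first four jets \<open>y0\<close>
  to \<open>y3\<close>. The constant \<open>e\<close> enters only at order four, since further
  differentiation removes it.\<close>

fun wiggly_deriv :: "real \<Rightarrow> real \<Rightarrow> real \<Rightarrow> real \<Rightarrow> real \<Rightarrow> real \<Rightarrow> real \<Rightarrow> nat \<Rightarrow> real" where
  "wiggly_deriv p q e y0 y1 y2 y3 0 = y0"
| "wiggly_deriv p q e y0 y1 y2 y3 (Suc 0) = y1"
| "wiggly_deriv p q e y0 y1 y2 y3 (Suc (Suc 0)) = y2"
| "wiggly_deriv p q e y0 y1 y2 y3 (Suc (Suc (Suc 0))) = y3"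
| "wiggly_deriv p q e y0 y1 y2 y3 (Suc (Suc (Suc (Suc j)))) =
     - p * wiggly_deriv p q e y0 y1 y2 y3 (Suc (Suc j)) - q * wiggly_deriv p q e y0 y1 y2 y3 j
     - (if j = 0 then e else 0)"

text \<open>From order four on, the equation expresses each derivative through derivatives two and
  four orders lower. These are differentiable by strong induction on the order.\<close>

lemma smooth_real_on_fourth_order_ode:
  assumes y0: "\<And>s. s \<in> S \<Longrightarrow> (y0 has_real_derivative y1 s) (at s)"
    and y1: "\<And>s. s \<in> S \<Longrightarrow> (y1 has_real_derivative y2 s) (at s)"
    and y2: "\<And>s. s \<in> S \<Longrightarrow> (y2 has_real_derivative y3 s) (at s)"
    and y3: "\<And>s. s \<in> S \<Longrightarrow> (y3 has_real_derivative - p * y2 s - q * y0 s - e) (at s)"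
  shows "\<exists>F. smooth_real_on S y0 F \<and> (\<forall>s\<in>S. F 4 s = - p * F 2 s - q * F 0 s - e)"
proof -
  define F where "F = (\<lambda>j s. wiggly_deriv p q e (y0 s) (y1 s) (y2 s) (y3 s) j)"
  have "(F j has_real_derivative F (Suc j) s) (at s)" if s: "s \<in> S" for j s
  proof (induction j rule: less_induct)
    case (less j)
    have "j = 0 \<or> j = 1 \<or> j = 2 \<or> j = 3 \<or> j = Suc (Suc (Suc (Suc (j - 4))))"
      by arith
    then consider "j = 0" | "j = 1" | "j = 2" | "j = 3" | i where "j = Suc (Suc (Suc (Suc i)))"
      by blast
    then show ?case
    proof cases
      case (5 i)
      have "(F j has_real_derivative - p * F (Suc (Suc (Suc i))) s - q * F (Suc i) s) (at s)"
      proof -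
        have "F j = (\<lambda>s. - p * F (Suc (Suc i)) s - q * F i s - (if i = 0 then e else 0))"
          by (simp add: 5 F_def)
        moreover have "((\<lambda>s. - p * F (Suc (Suc i)) s - q * F i s - (if i = 0 then e else 0)) has_real_derivative
            - p * F (Suc (Suc (Suc i))) s - q * F (Suc i) s - 0) (at s)"
          using 5 by (intro DERIV_diff DERIV_cmult DERIV_const less.IH) auto
        ultimately show ?thesis
          by simp
      qed
      then show ?thesis
        by (simp add: 5 F_def)
    qed (use s y0 y1 y2 y3 in \<open>auto simp: F_def eval_nat_numeral\<close>)
  qed
  moreover have "F 4 s = - p * F 2 s - q * F 0 s - e" for s
    by (simp add: F_def eval_nat_numeral)
  ultimately have "smooth_real_on S y0 F \<and> (\<forall>s\<in>S. F 4 s = - p * F 2 s - q * F 0 s - e)"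
    by (auto simp: smooth_real_on_def F_def)
  then show ?thesis by blast
qed

section \<open>Variation of the energy in \<open>H^2\<close>\<close>

text \<open>Perturbing by a multiple of \<open>M *v p\<close> cancels the inverse in the cross term
  and in the quadratic term, so the expansion is exact and both terms are explicit.\<close>

lemma Minv_norm2_add_scaleR:
  fixes M :: "real^'n^'n"
  assumes "transpose M = M" "\<forall>x. x \<noteq> 0 \<longrightarrow> x \<bullet> (M *v x) > 0"
  shows "Minv_norm2 M (x + c *\<^sub>R (M *v p)) = Minv_norm2 M x + 2 * c * (p \<bullet> x) + c\<^sup>2 * (p \<bullet> (M *v p))"
proof -
  \<comment> \<open>Positive definiteness gives a trivial kernel, hence invertibility, without which
    \<open>matrix_inv\<close> would be an arbitrary choice.\<close>
  have "M *v x = 0 \<Longrightarrow> x = 0" for x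
    using assms(2) by (metis inner_zero_right less_irrefl)
  then have "invertible M"
    by (meson invertible_left_inverse matrix_left_invertible_ker)
  then have inv: "matrix_inv M ** M = mat 1" "M ** matrix_inv M = mat 1"
    unfolding invertible_def matrix_inv_def by (metis (mono_tags, lifting) someI_ex)+
  have sym: "(M *v v) \<bullet> w = v \<bullet> (M *v w)" for v w
    using dot_lmul_matrix[of v M w] assms(1) by (metis transpose_matrix_vector)
  have "matrix_inv M *v (x + c *\<^sub>R (M *v p)) = matrix_inv M *v x + c *\<^sub>R p"
    by (simp add: matrix_vector_right_distrib matrix_vector_mult_scaleR matrix_vector_mul_assoc inv)
  moreover have "(M *v p) \<bullet> (matrix_inv M *v x) = p \<bullet> x"
    by (simp add: sym matrix_vector_mul_assoc inv)
  ultimately show ?thesis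
    by (simp add: Minv_norm2_def inner_simps sym inner_commute[of x p] power2_eq_square distrib_left mult_ac)
qed

lemma H2_on_D:
  assumes "H2_on a b u u' u''"
  shows H2_on_deriv: "\<And>s. s \<in> {a..b} \<Longrightarrow> (u has_vector_derivative u' s) (at s within {a..b})"
    and H2_on_absolutely_integrable: "u'' absolutely_integrable_on {a..b}"
    and H2_on_integrable: "u'' integrable_on {a..b}"
    and H2_on_square_integrable: "(\<lambda>s. (norm (u'' s))\<^sup>2) integrable_on {a..b}"
    and H2_on_eq: "\<And>s. s \<in> {a..b} \<Longrightarrow> u' s = u' a + integral {a..s} u''"
    and H2_on_continuous: "continuous_on {a..b} u"
    and H2_on_continuous_deriv: "continuous_on {a..b} u'"
proof -
  show 1: "\<And>s. s \<in> {a..b} \<Longrightarrow> (u has_vector_derivative u' s) (at s within {a..b})"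
    and "u'' absolutely_integrable_on {a..b}" and 2: "u'' integrable_on {a..b}"
    and "(\<lambda>s. (norm (u'' s))\<^sup>2) integrable_on {a..b}"
    and 3: "\<And>s. s \<in> {a..b} \<Longrightarrow> u' s = u' a + integral {a..s} u''"
    using assms unfolding H2_on_def absolutely_integrable_on_def by blast+
  show "continuous_on {a..b} u"
    using 1 has_vector_derivative_continuous continuous_on_eq_continuous_within by blast
  have "continuous_on {a..b} (\<lambda>s. u' a + integral {a..s} u'')"
    by (intro continuous_intros indefinite_integral_continuous_1 2)
  then show "continuous_on {a..b} u'"
    by (rule continuous_on_eq) (rule 3[symmetric])
qed

lemma bdd_meas_scaleR_absolutely_integrable:
  fixes p :: "'a::euclidean_space"
  assumes "bdd_meas {a..b} \<psi>"
  shows "(\<lambda>s. \<psi> s *\<^sub>R p) absolutely_integrable_on {a..b}"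
  using absolutely_integrable_linear[OF bdd_meas_absolutely_integrable[OF assms] bounded_linear_scaleR_left[of p]]
  by (simp add: o_def)

text \<open>The variation is admissible. Square integrability follows by expanding the norm: the
  cross term is a bounded function times an integrable one, and the last term is bounded.\<close>

lemma H2_on_add_double_integral:
  fixes p :: "'a::euclidean_space"
  assumes H: "H2_on a b u u' u''" and \<psi>: "bdd_meas {a..b} \<psi>"
  shows "H2_on a b (\<lambda>s. u s + integral {a..s} (\<lambda>s. integral {a..s} \<psi>) *\<^sub>R p)
    (\<lambda>s. u' s + integral {a..s} \<psi> *\<^sub>R p) (\<lambda>s. u'' s + \<psi> s *\<^sub>R p)"
  unfolding H2_on_def
proof (intro conjI ballI)
  have \<psi>i: "\<psi> integrable_on {a..b}"
    using \<psi> by (rule bdd_meas_integrable)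
  have cont: "continuous_on {a..b} (\<lambda>s. integral {a..s} \<psi>)"
    by (rule indefinite_integral_continuous_1[OF \<psi>i])
  fix s assume s: "s \<in> {a..b}"
  show "((\<lambda>s. u s + integral {a..s} (\<lambda>s. integral {a..s} \<psi>) *\<^sub>R p) has_vector_derivative
      u' s + integral {a..s} \<psi> *\<^sub>R p) (at s within {a..b})"
    by (intro has_vector_derivative_add H2_on_deriv[OF H s]
        bounded_linear.has_vector_derivative[OF bounded_linear_scaleR_left]
        integral_has_vector_derivative[OF cont s])
  have sub: "\<psi> integrable_on {a..s}" "u'' integrable_on {a..s}"
    using s by (auto intro: integrable_subinterval_real[OF \<psi>i] integrable_subinterval_real[OF H2_on_integrable[OF H]])
  have "((\<lambda>s. \<psi> s *\<^sub>R p) has_integral integral {a..s} \<psi> *\<^sub>R p) {a..s}"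
    using has_integral_linear[OF integrable_integral[OF sub(1)] bounded_linear_scaleR_left[of p]] by (simp add: o_def)
  then have "((\<lambda>s. u'' s + \<psi> s *\<^sub>R p) has_integral (integral {a..s} u'' + integral {a..s} \<psi> *\<^sub>R p)) {a..s}"
    using integrable_integral[OF sub(2)] by (intro has_integral_add)
  from integral_unique[OF this]
  show "u' s + integral {a..s} \<psi> *\<^sub>R p
      = u' a + integral {a..a} \<psi> *\<^sub>R p + integral {a..s} (\<lambda>s. u'' s + \<psi> s *\<^sub>R p)"
    using H2_on_eq[OF H s] by simp
next
  show "(\<lambda>s. u'' s + \<psi> s *\<^sub>R p) absolutely_integrable_on {a..b}"
    by (intro set_integral_add(1) H2_on_absolutely_integrable[OF H] bdd_meas_scaleR_absolutely_integrable[OF \<psi>])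
  have "(\<lambda>s. u'' s \<bullet> p) absolutely_integrable_on {a..b}"
    using absolutely_integrable_linear[OF H2_on_absolutely_integrable[OF H] bounded_linear_inner_left[of p]]
    by (simp add: o_def)
  then have "(\<lambda>s. (2 * \<psi> s) * (u'' s \<bullet> p)) integrable_on {a..b}"
    using bdd_meas_mult_absolutely_integrable[OF bdd_meas_mult[OF bdd_meas_const[of _ 2] \<psi>]]
    by (auto simp: absolutely_integrable_on_def)
  moreover have "(\<lambda>s. (\<psi> s)\<^sup>2 * (norm p)\<^sup>2) integrable_on {a..b}"
    by (intro bdd_meas_integrable bdd_meas_mult bdd_meas_power2 \<psi> bdd_meas_const)
  ultimately have "(\<lambda>s. (norm (u'' s))\<^sup>2 + (2 * \<psi> s) * (u'' s \<bullet> p) + (\<psi> s)\<^sup>2 * (norm p)\<^sup>2) integrable_on {a..b}"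
    by (intro integrable_add H2_on_square_integrable[OF H])
  moreover have "(norm (u'' s + \<psi> s *\<^sub>R p))\<^sup>2
      = (norm (u'' s))\<^sup>2 + (2 * \<psi> s) * (u'' s \<bullet> p) + (\<psi> s)\<^sup>2 * (norm p)\<^sup>2" for s
    unfolding power2_norm_eq_inner
    by (simp add: inner_simps inner_commute[of p "u'' s"] power2_eq_square algebra_simps)
  ultimately show "(\<lambda>s. (norm (u'' s + \<psi> s *\<^sub>R p))\<^sup>2) integrable_on {a..b}"
    by simp
qed

lemma H2_on_residual_absolutely_integrable:
  fixes M D K :: "real^'n^'n"
  assumes H: "H2_on a b u u' u''"
  shows "(\<lambda>s. M *v u'' s + D *v u' s + K *v u s + g) absolutely_integrable_on {a..b}"
proof -
  have "(\<lambda>s. M *v u'' s) absolutely_integrable_on {a..b}"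
    using absolutely_integrable_linear[OF H2_on_absolutely_integrable[OF H] matrix_vector_mul_bounded_linear[of M]]
    by (simp add: o_def)
  moreover have "(\<lambda>s. D *v u' s + (K *v u s + g)) absolutely_integrable_on {a..b}"
    by (intro absolutely_integrable_continuous_real continuous_intros
        bounded_linear.continuous_on[OF matrix_vector_mul_bounded_linear] H2_on_continuous[OF H] H2_on_continuous_deriv[OF H])
  ultimately show ?thesis
    using set_integral_add(1) by (fastforce simp: add.assoc)
qed

text \<open>The residual is \<open>M *v u''\<close> plus a continuous term, so the quadratic form is
  measurable and dominated by a multiple of \<open>(norm (u'' s))\<^sup>2\<close> plus a constant.
  Integrability is what allows the energy of a variation to be split into separate
  integrals.\<close>

lemma H2_on_Minv_norm2_integrable:
  fixes M D K :: "real^'n^'n"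
  assumes H: "H2_on a b u u' u''"
  shows "(\<lambda>s. Minv_norm2 M (M *v u'' s + D *v u' s + K *v u s + g)) integrable_on {a..b}"
proof -
  define R where "R = (\<lambda>s. M *v u'' s + D *v u' s + K *v u s + g)"
  define c where "c = (\<lambda>s. D *v u' s + (K *v u s + g))"
  have "continuous_on {a..b} c"
    unfolding c_def by (intro continuous_intros
        bounded_linear.continuous_on[OF matrix_vector_mul_bounded_linear] H2_on_continuous[OF H] H2_on_continuous_deriv[OF H])
  then have "bounded (c ` {a..b})"
    by (simp add: compact_imp_bounded compact_continuous_image)
  then obtain C0 where C0: "\<And>s. s \<in> {a..b} \<Longrightarrow> norm (c s) \<le> C0"
    unfolding bounded_iff by blast
  obtain C1 where C1: "\<And>x. norm (M *v x) \<le> norm x * C1"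
    using bounded_linear.bounded[OF matrix_vector_mul_bounded_linear[of M]] by blast
  obtain C2 where C2: "\<And>x. norm (matrix_inv M *v x) \<le> norm x * C2" "C2 \<ge> 0"
    using bounded_linear.nonneg_bounded[OF matrix_vector_mul_bounded_linear[of "matrix_inv M"]] by blast
  have "(\<lambda>s. Minv_norm2 M (R s)) integrable_on {a..b}"
  proof (rule measurable_bounded_by_integrable_imp_integrable)
    have "R \<in> borel_measurable (lebesgue_on {a..b})"
      unfolding R_def by (intro absolutely_integrable_imp_borel_measurable H2_on_residual_absolutely_integrable[OF H]) auto
    moreover have "continuous_on UNIV (Minv_norm2 M)"
      unfolding Minv_norm2_def[abs_def]
      by (intro continuous_intros bounded_linear.continuous_on[OF matrix_vector_mul_bounded_linear])
    ultimately show "(\<lambda>s. Minv_norm2 M (R s)) \<in> borel_measurable (lebesgue_on {a..b})"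
      using borel_measurable_continuous_on by blast
    show "(\<lambda>s. C2 * (2 * C1\<^sup>2 * (norm (u'' s))\<^sup>2 + 2 * C0\<^sup>2)) integrable_on {a..b}"
      by (intro integrable_on_mult_right integrable_add H2_on_square_integrable[OF H] integrable_const_ivl)
    fix s assume s: "s \<in> {a..b}"
    have "norm (R s) \<le> norm (M *v u'' s) + norm (c s)"
      unfolding R_def c_def using norm_triangle_ineq[of "M *v u'' s"] by (simp add: add.assoc)
    also have "\<dots> \<le> norm (u'' s) * C1 + C0"
      using C1[of "u'' s"] C0[OF s] by simp
    finally have "(norm (R s))\<^sup>2 \<le> (norm (u'' s) * C1 + C0)\<^sup>2"
      by (intro power_mono) auto
    also have "\<dots> \<le> 2 * C1\<^sup>2 * (norm (u'' s))\<^sup>2 + 2 * C0\<^sup>2"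
      using sum_squares_bound[of "norm (u'' s) * C1" C0] by (simp add: power2_sum power_mult_distrib mult_ac)
    finally have *: "(norm (R s))\<^sup>2 \<le> 2 * C1\<^sup>2 * (norm (u'' s))\<^sup>2 + 2 * C0\<^sup>2" .
    have "norm (Minv_norm2 M (R s)) \<le> norm (R s) * norm (matrix_inv M *v R s)"
      unfolding Minv_norm2_def real_norm_def by (rule Cauchy_Schwarz_ineq2)
    also have "\<dots> \<le> norm (R s) * (norm (R s) * C2)"
      by (intro mult_left_mono C2) auto
    also have "\<dots> = C2 * (norm (R s))\<^sup>2"
      by (simp add: power2_eq_square mult_ac)
    also have "\<dots> \<le> C2 * (2 * C1\<^sup>2 * (norm (u'' s))\<^sup>2 + 2 * C0\<^sup>2)"
      using * C2(2) by (rule mult_left_mono)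
    finally show "norm (Minv_norm2 M (R s)) \<le> C2 * (2 * C1\<^sup>2 * (norm (u'' s))\<^sup>2 + 2 * C0\<^sup>2)" .
  qed auto
  then show ?thesis
    by (simp add: R_def)
qed

text \<open>Since \<open>p\<close> is a joint eigenvector relative to \<open>M\<close>, the residual
  changes by the scalar function \<open>L\<close> times \<open>M *v p\<close>. Hence the mode
  decouples from the others and the energy expands exactly to second order.\<close>

lemma energyE_add_double_integral:
  fixes M D K :: "real^'n^'n" and \<kappa> l :: real
  assumes M: "transpose M = M" "\<forall>x. x \<noteq> 0 \<longrightarrow> x \<bullet> (M *v x) > 0"
    and p: "D *v p = \<kappa> *\<^sub>R (M *v p)" "K *v p = l *\<^sub>R (M *v p)"
    and H: "H2_on a b u u' u''" and \<psi>: "bdd_meas {a..b} \<psi>"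
  defines "L \<equiv> \<lambda>s. \<psi> s + \<kappa> * integral {a..s} \<psi> + l * integral {a..s} (\<lambda>s. integral {a..s} \<psi>)"
  shows "energyE M D K g a b (\<lambda>s. u s + integral {a..s} (\<lambda>s. integral {a..s} \<psi>) *\<^sub>R p)
      (\<lambda>s. u' s + integral {a..s} \<psi> *\<^sub>R p) (\<lambda>s. u'' s + \<psi> s *\<^sub>R p)
    = energyE M D K g a b u u' u'' + integral {a..b} (\<lambda>s. L s * (p \<bullet> (M *v u'' s + D *v u' s + K *v u s + g)))
      + integral {a..b} (\<lambda>s. (L s)\<^sup>2) * (p \<bullet> (M *v p)) / 2"
proof -
  define R where "R = (\<lambda>s. M *v u'' s + D *v u' s + K *v u s + g)"
  have \<Psi>: "bdd_meas {a..b} (\<lambda>s. integral {a..s} \<psi>)"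
    by (intro bdd_meas_indefinite_integral bdd_meas_integrable \<psi>)
  have L: "bdd_meas {a..b} L"
    unfolding L_def by (intro bdd_meas_add bdd_meas_mult bdd_meas_const \<psi> \<Psi>
        bdd_meas_indefinite_integral[OF bdd_meas_integrable])
  have "(\<lambda>s. p \<bullet> R s) absolutely_integrable_on {a..b}"
    using absolutely_integrable_linear[OF H2_on_residual_absolutely_integrable[OF H] bounded_linear_inner_right[of p]]
    by (simp add: o_def R_def)
  then have Lr: "(\<lambda>s. L s * (p \<bullet> R s)) integrable_on {a..b}"
    using bdd_meas_mult_absolutely_integrable[OF L] by (auto simp: absolutely_integrable_on_def)
  have L2: "(\<lambda>s. (L s)\<^sup>2) integrable_on {a..b}"
    by (intro bdd_meas_integrable bdd_meas_power2 L)
  have E: "(\<lambda>s. Minv_norm2 M (R s)) integrable_on {a..b}"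
    unfolding R_def by (rule H2_on_Minv_norm2_integrable[OF H])
  have "M *v (u'' s + \<psi> s *\<^sub>R p) + D *v (u' s + integral {a..s} \<psi> *\<^sub>R p)
      + K *v (u s + integral {a..s} (\<lambda>s. integral {a..s} \<psi>) *\<^sub>R p) + g = R s + L s *\<^sub>R (M *v p)" for s
    by (simp add: R_def L_def matrix_vector_right_distrib matrix_vector_mult_scaleR p algebra_simps)
  then have "energyE M D K g a b (\<lambda>s. u s + integral {a..s} (\<lambda>s. integral {a..s} \<psi>) *\<^sub>R p)
      (\<lambda>s. u' s + integral {a..s} \<psi> *\<^sub>R p) (\<lambda>s. u'' s + \<psi> s *\<^sub>R p)
    = 1/2 * integral {a..b} (\<lambda>s. Minv_norm2 M (R s) + 2 * (L s * (p \<bullet> R s)) + (L s)\<^sup>2 * (p \<bullet> (M *v p)))"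
    by (simp add: energyE_def Minv_norm2_add_scaleR[OF M] mult.assoc)
  also have "\<dots> = 1/2 * (integral {a..b} (\<lambda>s. Minv_norm2 M (R s)) + 2 * integral {a..b} (\<lambda>s. L s * (p \<bullet> R s))
      + integral {a..b} (\<lambda>s. (L s)\<^sup>2) * (p \<bullet> (M *v p)))"
    using Lr L2 E by (simp add: integral_add integrable_add integrable_on_mult_left integrable_on_mult_right)
  finally show ?thesis
    by (simp add: energyE_def R_def field_simps)
qed

lemma linear_term_zero_if_nonneg:
  fixes h q :: real
  assumes "\<And>e. 0 \<le> e * h + e\<^sup>2 * q"
  shows "h = 0"
proof (rule ccontr)
  assume "h \<noteq> 0"
  \<comment> \<open>With \<open>c\<close> larger than \<open>q\<close>, the step
    \<open>-(h / c)\<close> is short enough that the quadratic term cannot outweigh the linear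
    decrease.\<close>
  define c where "c = \<bar>q\<bar> + 1"
  have c: "c > 0" "q - c < 0"
    by (auto simp: c_def)
  have "0 \<le> - (h / c) * h + (- (h / c))\<^sup>2 * q"
    by (rule assms)
  also have "\<dots> = (h / c)\<^sup>2 * (q - c)"
    using c by (simp add: field_simps power2_eq_square)
  also have "\<dots> < 0"
    using c \<open>h \<noteq> 0\<close> by (intro mult_pos_neg) auto
  finally show False by simp
qed

section \<open>Modal coordinates and the first-order condition\<close>

text \<open>With \<open>Q\<close> the matrix of rows \<open>\<phi> i\<close>, orthonormality says
  that \<open>transpose Q\<close> is a right inverse of \<open>Q ** M\<close>. For square matrices
  it is then also a left inverse, which is the expansion.\<close>

lemma orthonormal_expansion:
  fixes M :: "real^'n^'n" and \<phi> :: "'n \<Rightarrow> real^'n"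
  assumes "\<forall>i j. \<phi> i \<bullet> (M *v \<phi> j) = (if i = j then 1 else 0)"
  shows "x = (\<Sum>i\<in>UNIV. (\<phi> i \<bullet> (M *v x)) *\<^sub>R \<phi> i)"
proof -
  define Q :: "real^'n^'n" where "Q = (\<chi> i. \<phi> i)"
  have QT: "transpose Q *v y = (\<Sum>i\<in>UNIV. y $ i *\<^sub>R \<phi> i)" for y
    by (simp add: matrix_mult_sum Q_def row_def scalar_mult_eq_scaleR)
  have Q: "(Q *v y) $ i = \<phi> i \<bullet> y" for y i
    by (simp add: matrix_vector_mul_component Q_def)
  have "(Q ** M ** transpose Q) *v y = mat 1 *v y" for y
  proof (subst vec_eq_iff, intro allI)
    fix i
    have "((Q ** M ** transpose Q) *v y) $ i = \<phi> i \<bullet> (M *v (\<Sum>j\<in>UNIV. y $ j *\<^sub>R \<phi> j))"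
      unfolding matrix_vector_mul_assoc[symmetric] Q QT ..
    also have "\<dots> = (\<Sum>j\<in>UNIV. y $ j * (\<phi> i \<bullet> (M *v \<phi> j)))"
      by (simp add: linear_sum[OF matrix_vector_mul_linear] matrix_vector_mult_scaleR inner_sum_right)
    also have "\<dots> = (mat 1 *v y) $ i"
      using assms by (simp add: if_distrib[of "(*) _"] cong: if_cong)
    finally show "((Q ** M ** transpose Q) *v y) $ i = (mat 1 *v y) $ i" .
  qed
  then have "Q ** M ** transpose Q = mat 1"
    by (metis matrix_eq)
  then have "transpose Q ** (Q ** M) = mat 1"
    using matrix_left_right_inverse by blast
  then have "x = transpose Q *v (Q *v (M *v x))"
    by (simp add: matrix_vector_mul_assoc matrix_mul_assoc)
  then show ?thesis
    unfolding QT Q .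
qed

text \<open>Scaling the direction to \<open>e *\<^sub>R p\<close> leaves the node terms unchanged
  and makes the change in \<open>E\<close> a polynomial in \<open>e\<close> without constant term.
  It is nonnegative for both signs of \<open>e\<close>, so its linear coefficient, the stated
  integral, vanishes.\<close>

lemma minimizer_weak_equation:
  fixes M D K :: "real^'n^'n" and \<kappa> l :: real
  assumes M: "transpose M = M" "\<forall>x. x \<noteq> 0 \<longrightarrow> x \<bullet> (M *v x) > 0"
    and p: "D *v p = \<kappa> *\<^sub>R (M *v p)" "K *v p = l *\<^sub>R (M *v p)"
    and H: "H2_on (t 0) (t m) u u' u''"
    and u_min: "\<forall>v v' v''. H2_on (t 0) (t m) v v' v'' \<longrightarrow>
        energyE M D K g (t 0) (t m) u u' u'' + energyWC cA cB A a B b W DW t m u u'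
        \<le> energyE M D K g (t 0) (t m) v v' v'' + energyWC cA cB A a B b W DW t m v v'"
    and \<psi>: "bdd_meas {t 0..t m} \<psi>"
    and val0: "\<And>k. k \<le> m \<Longrightarrow> integral {t 0..t k} (\<lambda>s. integral {t 0..s} \<psi>) = 0"
    and deriv0: "\<And>k. k \<le> m \<Longrightarrow> B k \<noteq> [] \<Longrightarrow> integral {t 0..t k} \<psi> = 0"
  shows "integral {t 0..t m} (\<lambda>s. (\<psi> s + \<kappa> * integral {t 0..s} \<psi> + l * integral {t 0..s} (\<lambda>s. integral {t 0..s} \<psi>))
      * (p \<bullet> (M *v u'' s + D *v u' s + K *v u s + g))) = 0" (is "integral _ (\<lambda>s. ?L s * (p \<bullet> ?R s)) = 0")
proof (rule linear_term_zero_if_nonneg)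
  fix e :: real
  define v where "v = (\<lambda>s. u s + integral {t 0..s} (\<lambda>s. integral {t 0..s} \<psi>) *\<^sub>R (e *\<^sub>R p))"
  define v' where "v' = (\<lambda>s. u' s + integral {t 0..s} \<psi> *\<^sub>R (e *\<^sub>R p))"
  define v'' where "v'' = (\<lambda>s. u'' s + \<psi> s *\<^sub>R (e *\<^sub>R p))"
  have "H2_on (t 0) (t m) v v' v''"
    unfolding v_def v'_def v''_def by (rule H2_on_add_double_integral[OF H \<psi>])
  moreover have "energyWC cA cB A a B b W DW t m v v' = energyWC cA cB A a B b W DW t m u u'"
  proof -
    \<comment> \<open>If \<open>B k\<close> is empty the residual is an empty sum, so the velocity
      may change freely there; otherwise \<open>deriv0\<close> keeps it fixed.\<close>
    have "resid2 (B k) (b k) (DW (v (t k)) *v v' (t k)) = resid2 (B k) (b k) (DW (u (t k)) *v u' (t k))"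
      if "k \<le> m" for k
      using that val0[of k] deriv0[of k] by (cases "B k = []") (simp_all add: v_def v'_def resid2_def)
    then show ?thesis
      unfolding energyWC_def by (simp add: v_def val0)
  qed
  ultimately have "energyE M D K g (t 0) (t m) u u' u'' \<le> energyE M D K g (t 0) (t m) v v' v''"
    using u_min by fastforce
  moreover have ep: "D *v (e *\<^sub>R p) = \<kappa> *\<^sub>R (M *v (e *\<^sub>R p))" "K *v (e *\<^sub>R p) = l *\<^sub>R (M *v (e *\<^sub>R p))"
    by (simp_all add: matrix_vector_mult_scaleR p)
  have "energyE M D K g (t 0) (t m) v v' v'' = energyE M D K g (t 0) (t m) u u' u''
      + integral {t 0..t m} (\<lambda>s. ?L s * (e *\<^sub>R p \<bullet> ?R s))
      + integral {t 0..t m} (\<lambda>s. (?L s)\<^sup>2) * (e *\<^sub>R p \<bullet> (M *v (e *\<^sub>R p))) / 2"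
    unfolding v_def v'_def v''_def by (rule energyE_add_double_integral[OF M ep H \<psi>])
  moreover have "integral {t 0..t m} (\<lambda>s. ?L s * (e *\<^sub>R p \<bullet> ?R s)) = e * integral {t 0..t m} (\<lambda>s. ?L s * (p \<bullet> ?R s))"
    unfolding inner_scaleR_left integral_mult_right[symmetric] by (intro integral_cong) (rule mult.left_commute)
  moreover have "integral {t 0..t m} (\<lambda>s. (?L s)\<^sup>2) * (e *\<^sub>R p \<bullet> (M *v (e *\<^sub>R p))) / 2
      = e\<^sup>2 * (integral {t 0..t m} (\<lambda>s. (?L s)\<^sup>2) * (p \<bullet> (M *v p)) / 2)"
    by (simp only: matrix_vector_mult_scaleR inner_scaleR_left inner_scaleR_right power2_eq_square) simp
  ultimately show "0 \<le> e * integral {t 0..t m} (\<lambda>s. ?L s * (p \<bullet> ?R s))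
      + e\<^sup>2 * (integral {t 0..t m} (\<lambda>s. (?L s)\<^sup>2) * (p \<bullet> (M *v p)) / 2)"
    by linarith
qed

section \<open>From the scalar modes to the minimizer\<close>

theorem theorem2:
  fixes M K D :: "real^'n^'n" and \<alpha> \<beta> :: real and g :: "real^'n"
    and t :: "nat \<Rightarrow> real" and m :: nat
    and W :: "real^'n \<Rightarrow> real^'n" and DW :: "real^'n \<Rightarrow> real^'n^'n"
    and D2W :: "real^'n \<Rightarrow> ((real^'n) \<Rightarrow>\<^sub>L (real^'n^'n))"
    and A B :: "nat \<Rightarrow> (real^'n) list" and a b :: "nat \<Rightarrow> real list" and cA cB :: real
    and \<phi> :: "'n \<Rightarrow> real^'n" and lam :: "'n \<Rightarrow> real"
    and u u' u'' :: "real \<Rightarrow> real^'n" and \<omega> :: "'n \<Rightarrow> real \<Rightarrow> real"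
  assumes M_sym: "transpose M = M" and M_pd: "\<forall>x. x \<noteq> 0 \<longrightarrow> x \<bullet> (M *v x) > 0"
    and K_sym: "transpose K = K" and K_psd: "\<forall>x. x \<bullet> (K *v x) \<ge> 0"
    and ab: "\<alpha> \<ge> 0" "\<beta> \<ge> 0" and D_def: "D = \<alpha> *\<^sub>R M + \<beta> *\<^sub>R K"
    and m_pos: "0 < m" and t_mono: "\<forall>k<m. t k < t (Suc k)"
    and W_deriv: "\<forall>x. (W has_derivative (\<lambda>h. DW x *v h)) (at x)"
    and DW_deriv: "\<forall>x. (DW has_derivative blinfun_apply (D2W x)) (at x)"
    and D2W_cont: "continuous_on UNIV D2W"
    and A_len: "\<forall>k\<le>m. length (a k) = length (A k)"
    and B_len: "\<forall>k\<le>m. length (b k) = length (B k)"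
    and cpos: "cA > 0" "cB > 0"
    and phi_orth: "\<forall>i j. \<phi> i \<bullet> (M *v \<phi> j) = (if i = j then 1 else 0)"
    and phi_eig: "\<forall>i. K *v \<phi> i = lam i *\<^sub>R (M *v \<phi> i)"
    and u_H2: "H2_on (t 0) (t m) u u' u''"
    and u_min: "\<forall>v v' v''. H2_on (t 0) (t m) v v' v'' \<longrightarrow>
        energyE M D K g (t 0) (t m) u u' u'' + energyWC cA cB A a B b W DW t m u u'
        \<le> energyE M D K g (t 0) (t m) v v' v'' + energyWC cA cB A a B b W DW t m v v'"
    and u_expand: "\<forall>s\<in>{t 0..t m}. u s = (\<Sum>i\<in>UNIV. \<omega> i s *\<^sub>R \<phi> i)"
  shows
    "(\<forall>i. \<forall>k\<in>{1..m}. \<exists>F. smooth_real_on {t (k - 1)<..<t k} (\<omega> i) F \<and>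
        (\<forall>s\<in>{t (k - 1)<..<t k}.
           F 4 s + 2 * (lam i - 2 * ((\<alpha> + \<beta> * lam i) / 2)\<^sup>2) * F 2 s
           + lam i * (lam i * F 0 s + \<phi> i \<bullet> g) = 0))
     \<and> continuous_on {t 0..t m} u'
     \<and> (\<forall>s\<in>{t 0..t m}. (u has_vector_derivative u' s) (at s within {t 0..t m}))
     \<and> (\<forall>k. 1 \<le> k \<and> k \<le> m - 1 \<and> B k = [] \<longrightarrow>
          (\<exists>acc. (u' has_vector_derivative acc) (at (t k))))"
proof -
  define N where "N = t ` {..m}"
  define N' where "N' = t ` {k. k \<le> m \<and> B k \<noteq> []}"
  have t_less: "t j < t k" if "j < k" "k \<le> m" for j k
    using that
  proof (induction k)
    case (Suc k)
    then show ?case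
      using t_mono[rule_format, of k] by (cases "j = k") auto
  qed simp
  have t_le: "t j \<le> t k" if "j \<le> k" "k \<le> m" for j k
    using t_less[of j k] that by (cases "j = k") auto
  have fin: "finite N" "finite N'"
    by (auto simp: N_def N'_def)
  have sub: "N \<subseteq> {t 0..t m}" "N' \<subseteq> {t 0..t m}"
    using t_le by (auto simp: N_def N'_def)
  \<comment> \<open>\<open>y i\<close> and \<open>y1 i\<close> are the modal coordinates of
    \<open>u\<close> and \<open>u'\<close>. On \<open>[t 0, t m]\<close> the former agrees with
    \<open>\<omega> i\<close>, whose values outside that interval are not constrained.\<close>
  define y where "y = (\<lambda>i s. \<phi> i \<bullet> (M *v u s))"
  define y1 where "y1 = (\<lambda>i s. \<phi> i \<bullet> (M *v u' s))"
  \<comment> \<open>The first conjunct also covers nodes outside \<open>N'\<close> and will yield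
    the second derivative there; the other two hold between nodes and will yield the fourth-order
    equation.\<close>
  have key: "\<exists>\<rho> \<sigma>. (\<forall>s\<in>{t 0<..<t m} - N'. (y1 i has_real_derivative \<rho> s - (\<alpha> + \<beta> * lam i) * y1 i s - lam i * y i s - \<phi> i \<bullet> g) (at s))
      \<and> (\<forall>s\<in>{t 0<..<t m} - N - N'. (\<rho> has_real_derivative \<sigma> s) (at s))
      \<and> (\<forall>s\<in>{t 0<..<t m} - N - N'. (\<sigma> has_real_derivative (\<alpha> + \<beta> * lam i) * \<sigma> s - lam i * \<rho> s) (at s))" for i
  proof -
    define \<kappa> where "\<kappa> = \<alpha> + \<beta> * lam i"
    have eig: "D *v \<phi> i = \<kappa> *\<^sub>R (M *v \<phi> i)" "K *v \<phi> i = lam i *\<^sub>R (M *v \<phi> i)"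
      using phi_eig by (simp_all add: D_def \<kappa>_def matrix_vector_mult_add_rdistrib scaleR_matrix_vector_assoc[symmetric]
          scaleR_left_distrib)
    have sym: "v \<bullet> (X *v w) = (X *v v) \<bullet> w" if "transpose X = X" for X :: "real^'n^'n" and v w
      using dot_lmul_matrix[of v X w] that by (metis transpose_matrix_vector)
    define r where "r = (\<lambda>s. \<phi> i \<bullet> (M *v u'' s + D *v u' s + K *v u s + g))"
    define z where "z = (\<lambda>s. \<kappa> * y1 i s + lam i * y i s + \<phi> i \<bullet> g)"
    have "transpose D = D"
      using M_sym K_sym by (simp add: D_def vec_eq_iff transpose_def)
    \<comment> \<open>Symmetry lets \<open>D\<close> and \<open>K\<close> act on the eigenvector
      instead, so the component of the residual along \<open>\<phi> i\<close> involves only mode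
      \<open>i\<close>.\<close>
    then have "\<phi> i \<bullet> (D *v x) = \<kappa> * (\<phi> i \<bullet> (M *v x))" "\<phi> i \<bullet> (K *v x) = lam i * (\<phi> i \<bullet> (M *v x))" for x
      using sym[of D] sym[OF K_sym] sym[OF M_sym] by (simp_all add: eig)
    then have r_eq: "r s = \<phi> i \<bullet> (M *v u'' s) + z s" for s
      by (simp add: r_def z_def y_def y1_def inner_simps)
    have "r absolutely_integrable_on {t 0..t m}"
      using absolutely_integrable_linear[OF H2_on_residual_absolutely_integrable[OF u_H2] bounded_linear_inner_right]
      by (simp add: o_def r_def)
    moreover have "integral {t 0..t m} (\<lambda>s. (\<psi> s + \<kappa> * integral {t 0..s} \<psi> + lam i * integral {t 0..s} (\<lambda>s. integral {t 0..s} \<psi>)) * r s) = 0"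
      if "bdd_meas {t 0..t m} \<psi>" "\<And>\<tau>. \<tau> \<in> N \<Longrightarrow> integral {t 0..\<tau>} (\<lambda>s. integral {t 0..s} \<psi>) = 0"
        "\<And>\<tau>. \<tau> \<in> N' \<Longrightarrow> integral {t 0..\<tau>} \<psi> = 0" for \<psi>
      unfolding r_def
      by (rule minimizer_weak_equation[OF M_sym M_pd eig u_H2 u_min that(1)]) (auto intro!: that(2,3) simp: N_def N'_def)
    ultimately obtain \<rho> \<sigma> where
      R: "\<And>s. s \<in> {t 0<..<t m} - N' \<Longrightarrow> ((\<lambda>x. integral {t 0..x} r) has_real_derivative \<rho> s) (at s)"
      and \<rho>: "\<And>s. s \<in> {t 0<..<t m} - N - N' \<Longrightarrow> (\<rho> has_real_derivative \<sigma> s) (at s)"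
      and \<sigma>: "\<And>s. s \<in> {t 0<..<t m} - N - N' \<Longrightarrow> (\<sigma> has_real_derivative \<kappa> * \<sigma> s - lam i * \<rho> s) (at s)"
      using weak_equation_regularity[of "t 0" "t m" r N N' \<kappa> "lam i"] t_le[of 0 m] fin sub by blast
    have cont_z: "continuous_on {t 0..t m} z"
      unfolding z_def y_def y1_def
      by (intro continuous_intros bounded_linear.continuous_on[OF matrix_vector_mul_bounded_linear]
          H2_on_continuous[OF u_H2] H2_on_continuous_deriv[OF u_H2])
    have ri: "r integrable_on {t 0..t m}" and zi: "z integrable_on {t 0..t m}"
      using \<open>r absolutely_integrable_on _\<close> integrable_continuous_real[OF cont_z]
      by (auto simp: absolutely_integrable_on_def)
    \<comment> \<open>\<open>u''\<close> is known only through its integral, so \<open>y1 i\<close>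
      is differentiated via the integral of \<open>r\<close>, whose derivative \<open>\<rho>\<close>
      is available, minus that of the continuous function \<open>z\<close>.\<close>
    have y1_eq: "y1 i x = y1 i (t 0) + (integral {t 0..x} r - integral {t 0..x} z)" if x: "x \<in> {t 0..t m}" for x
    proof -
      have sub': "f integrable_on {t 0..x}" if "f integrable_on {t 0..t m}" for f :: "real \<Rightarrow> 'b::banach"
        using x by (intro integrable_subinterval_real[OF that]) auto
      have "((\<lambda>s. \<phi> i \<bullet> (M *v u'' s)) has_integral (\<phi> i \<bullet> (M *v integral {t 0..x} u''))) {t 0..x}"
        using has_integral_linear[OF integrable_integral[OF sub'[OF H2_on_integrable[OF u_H2]]]
            bounded_linear_compose[OF bounded_linear_inner_right matrix_vector_mul_bounded_linear[of M], of "\<phi> i"]]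
        by (simp add: o_def)
      then have "\<phi> i \<bullet> (M *v integral {t 0..x} u'') = integral {t 0..x} (\<lambda>s. r s - z s)"
        by (simp add: r_eq integral_unique)
      also have "\<dots> = integral {t 0..x} r - integral {t 0..x} z"
        by (intro integral_diff sub' ri zi)
      finally show ?thesis
        unfolding y1_def by (subst H2_on_eq[OF u_H2 x]) (simp add: matrix_vector_right_distrib inner_add_right)
    qed
    have "(y1 i has_real_derivative \<rho> s - \<kappa> * y1 i s - lam i * y i s - \<phi> i \<bullet> g) (at s)"
      if s: "s \<in> {t 0<..<t m} - N'" for s
    proof (rule has_field_derivative_transform_within_open)
      have "isCont z s"
        using s cont_z by (auto intro: continuous_on_interior)
      then have "((\<lambda>x. integral {t 0..x} z) has_real_derivative z s) (at s)"
        using s by (intro integral_has_real_derivative_at[OF zi]) auto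
      then have "((\<lambda>x. y1 i (t 0) + (integral {t 0..x} r - integral {t 0..x} z)) has_real_derivative 0 + (\<rho> s - z s)) (at s)"
        using R[OF s] by (intro DERIV_add DERIV_diff DERIV_const)
      then show "((\<lambda>x. y1 i (t 0) + (integral {t 0..x} r - integral {t 0..x} z)) has_real_derivative
          \<rho> s - \<kappa> * y1 i s - lam i * y i s - \<phi> i \<bullet> g) (at s)"
        by (simp add: z_def diff_diff_eq)
      show "y1 i (t 0) + (integral {t 0..x} r - integral {t 0..x} z) = y1 i x" if "x \<in> {t 0<..<t m}" for x
        using y1_eq[of x] that by simp
    qed (use s in auto)
    then show ?thesis
      using \<rho> \<sigma> unfolding \<kappa>_def by blast
  qed
  have y_deriv: "(y i has_real_derivative y1 i s) (at s)" if s: "s \<in> {t 0<..<t m}" for i s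
  proof -
    have "(u has_vector_derivative u' s) (at s within {t 0..t m})"
      using s by (intro H2_on_deriv[OF u_H2]) auto
    moreover have "at s within {t 0..t m} = at s"
      using s by (intro at_within_interior) auto
    ultimately have "(u has_vector_derivative u' s) (at s)"
      by simp
    then show ?thesis
      unfolding y_def y1_def has_real_derivative_iff_has_vector_derivative
      by (rule bounded_linear.has_vector_derivative[OF
            bounded_linear_compose[OF bounded_linear_inner_right matrix_vector_mul_bounded_linear]])
  qed
  have \<omega>_eq: "y i s = \<omega> i s" if "s \<in> {t 0..t m}" for i s
  proof -
    have "y i s = (\<Sum>j\<in>UNIV. \<omega> j s * (\<phi> i \<bullet> (M *v \<phi> j)))"
      using u_expand that
      by (simp add: y_def linear_sum[OF matrix_vector_mul_linear] matrix_vector_mult_scaleR inner_sum_right)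
    then show ?thesis
      using phi_orth by (simp add: if_distrib[of "(*) _"] cong: if_cong)
  qed
  have wiggly: "\<exists>F. smooth_real_on {t (k - 1)<..<t k} (\<omega> i) F \<and>
        (\<forall>s\<in>{t (k - 1)<..<t k}.
           F 4 s + 2 * (lam i - 2 * ((\<alpha> + \<beta> * lam i) / 2)\<^sup>2) * F 2 s
           + lam i * (lam i * F 0 s + \<phi> i \<bullet> g) = 0)" if k: "k \<in> {1..m}" for i k
  proof -
    define \<kappa> where "\<kappa> = \<alpha> + \<beta> * lam i"
    define S where "S = {t (k - 1)<..<t k}"
    have "t j \<notin> S" if "j \<le> m" for j
    proof -
      have "j \<le> k - 1 \<and> k - 1 \<le> m \<or> k \<le> j"
        using k by auto
      then show ?thesis
        using t_le[of j "k - 1"] t_le[of k j] that by (auto simp: S_def)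
    qed
    moreover have "t 0 \<le> t (k - 1)" "t k \<le> t m"
      using k by (auto intro!: t_le)
    ultimately have S: "S \<subseteq> {t 0<..<t m} - N - N'" "S \<subseteq> {t 0..t m}" "S \<subseteq> {t 0<..<t m}" "S \<subseteq> {t 0<..<t m} - N'"
      by (auto simp: S_def N_def N'_def)
    obtain \<rho> \<sigma> where
      y1: "\<And>s. s \<in> S \<Longrightarrow> (y1 i has_real_derivative \<rho> s - \<kappa> * y1 i s - lam i * y i s - \<phi> i \<bullet> g) (at s)"
      and \<rho>: "\<And>s. s \<in> S \<Longrightarrow> (\<rho> has_real_derivative \<sigma> s) (at s)"
      and \<sigma>: "\<And>s. s \<in> S \<Longrightarrow> (\<sigma> has_real_derivative \<kappa> * \<sigma> s - lam i * \<rho> s) (at s)"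
      using key[of i] S unfolding \<kappa>_def by blast
    define y2 where "y2 = (\<lambda>s. \<rho> s - \<kappa> * y1 i s - lam i * y i s - \<phi> i \<bullet> g)"
    define y3 where "y3 = (\<lambda>s. \<sigma> s - \<kappa> * y2 s - lam i * y1 i s)"
    have y: "(y i has_real_derivative y1 i s) (at s)" if "s \<in> S" for s
      using y_deriv S that by blast
    have y1': "(y1 i has_real_derivative y2 s) (at s)" if "s \<in> S" for s
      using y1[OF that] by (simp add: y2_def)
    have y2': "(y2 has_real_derivative y3 s) (at s)" if "s \<in> S" for s
    proof -
      have "(y2 has_real_derivative \<sigma> s - \<kappa> * y2 s - lam i * y1 i s - 0) (at s)"
        unfolding y2_def using that
        by (intro DERIV_diff DERIV_cmult DERIV_const \<rho> y y1'[unfolded y2_def])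
      then show ?thesis
        by (simp add: y3_def)
    qed
    have y3': "(y3 has_real_derivative - (2 * lam i - \<kappa>\<^sup>2) * y2 s - (lam i)\<^sup>2 * y i s - lam i * (\<phi> i \<bullet> g)) (at s)"
      if "s \<in> S" for s
    proof -
      have "(y3 has_real_derivative (\<kappa> * \<sigma> s - lam i * \<rho> s) - \<kappa> * y3 s - lam i * y2 s) (at s)"
        unfolding y3_def using that
        by (intro DERIV_diff DERIV_cmult \<sigma> y1' y2'[unfolded y3_def])
      \<comment> \<open>Eliminating \<open>\<rho>\<close> and \<open>\<sigma>\<close> through the
        definitions of \<open>y2\<close> and \<open>y3\<close> cancels the odd-order terms: the
        factor with damping \<open>+\<kappa>\<close> from the residual meets the adjoint factor with
        \<open>-\<kappa>\<close>.\<close>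
      also have "(\<kappa> * \<sigma> s - lam i * \<rho> s) - \<kappa> * y3 s - lam i * y2 s
          = - (2 * lam i - \<kappa>\<^sup>2) * y2 s - (lam i)\<^sup>2 * y i s - lam i * (\<phi> i \<bullet> g)"
        by (simp add: y3_def y2_def power2_eq_square algebra_simps)
      finally show ?thesis .
    qed
    have "\<exists>F. smooth_real_on S (y i) F \<and>
        (\<forall>s\<in>S. F 4 s = - (2 * lam i - \<kappa>\<^sup>2) * F 2 s - (lam i)\<^sup>2 * F 0 s - lam i * (\<phi> i \<bullet> g))"
      by (rule smooth_real_on_fourth_order_ode) (fact y y1' y2' y3')+
    then obtain F where F: "smooth_real_on S (y i) F"
      "\<And>s. s \<in> S \<Longrightarrow> F 4 s = - (2 * lam i - \<kappa>\<^sup>2) * F 2 s - (lam i)\<^sup>2 * F 0 s - lam i * (\<phi> i \<bullet> g)"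
      by metis
    have "smooth_real_on S (\<omega> i) F"
    proof -
      have "F 0 s = \<omega> i s" if "s \<in> S" for s
        using F(1) \<omega>_eq[OF subsetD[OF S(2) that], of i] that by (simp add: smooth_real_on_def)
      then show ?thesis
        using F(1) by (simp add: smooth_real_on_def)
    qed
    moreover have "F 4 s + 2 * (lam i - 2 * (\<kappa> / 2)\<^sup>2) * F 2 s + lam i * (lam i * F 0 s + \<phi> i \<bullet> g) = 0" if "s \<in> S" for s
      unfolding F(2)[OF that] by (simp add: power2_eq_square algebra_simps)
    ultimately show ?thesis
      unfolding S_def \<kappa>_def by blast
  qed
  have second: "\<exists>acc. (u' has_vector_derivative acc) (at (t k))" if k: "1 \<le> k \<and> k \<le> m - 1 \<and> B k = []" for k
  proof -
    have k_le: "k \<le> m" "k < m"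
      using k m_pos by auto
    \<comment> \<open>\<open>N'\<close> is a set of times, so strict monotonicity is needed to
      exclude another index with a prescribed velocity at the same time.\<close>
    have "t k \<notin> N'"
    proof
      assume "t k \<in> N'"
      then obtain j where j: "j \<le> m" "B j \<noteq> []" "t j = t k"
        by (auto simp: N'_def)
      then show False
        using t_less[of j k] t_less[of k j] k k_le by (cases j k rule: linorder_cases) auto
    qed
    moreover have "t k \<in> {t 0<..<t m}"
      using t_less[of 0 k] t_less[of k m] k k_le by auto
    ultimately have "\<exists>d. (y1 i has_real_derivative d) (at (t k))" for i
      using key[of i] by blast
    then obtain d where d: "\<And>i. (y1 i has_real_derivative d i) (at (t k))"
      by metis
    have "((\<lambda>s. \<Sum>i\<in>UNIV. y1 i s *\<^sub>R \<phi> i) has_vector_derivative (\<Sum>i\<in>UNIV. d i *\<^sub>R \<phi> i)) (at (t k))"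
      using d unfolding has_real_derivative_iff_has_vector_derivative
      by (intro has_vector_derivative_sum bounded_linear.has_vector_derivative[OF bounded_linear_scaleR_left])
    \<comment> \<open>The expansion holds for every vector, so this is an equality of functions on
      the whole line and the two-sided derivative carries over to \<open>u'\<close>.\<close>
    moreover have "(\<lambda>s. \<Sum>i\<in>UNIV. y1 i s *\<^sub>R \<phi> i) = u'"
      unfolding y1_def using orthonormal_expansion[OF phi_orth] by (intro ext) simp
    ultimately show ?thesis
      by auto
  qed
  show ?thesis
    using wiggly second H2_on_continuous_deriv[OF u_H2] H2_on_deriv[OF u_H2] by blast
qed

end
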